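(* Let $r>0$, $\sigma^2>0$, $\Omega\in\mathbb{R}\setminus\{0\}$, $\rho=\frac{2\sigma^2}{r}$, and let $A$ be the Ornstein-Uhlenbeck operator in $L^2_{\mathbb{C}}(\mu)$ given by $$A = (-rx+\Omega y)\frac{\partial}{\partial x} + (-\Omega x-ry)\frac{\partial}{\partial y} +\sigma^2\Big(\frac{\partial^2}{\partial x^2}+\frac{\partial^2}{\partial y^2}\Big).$$ For all integers $m,n\ge 0$, the eigenfunction of $A$ (up to a multiplicative constant) associated with the eigenvalue $-r(m+n)-\mathrm{i}(m-n)\Omega$ is $$J_{m,n}(x,y)=\begin{cases}(-1)^n\, n!\,(x+\mathrm{i}y)^{m-n}L_n^{m-n}(x^2+y^2,\rho), & m\ge n,\\ (-1)^m\, m!\,(x-\mathrm{i}y)^{n-m}L_m^{n-m}(x^2+y^2,\rho), & m<n,\end{cases}$$ where $L_n^{\alpha}(\cdot,\rho)$ are the Laguerre polynomials with parameter $\rho$.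
   Context: $\mathrm{i}=\sqrt{-1}$. The measure $\mu$ on $\mathbb{R}^2$ is $\mathrm{d}\mu=\frac{r}{2\pi\sigma^2}\exp\{-\frac{r(x^2+y^2)}{2\sigma^2}\}\,\mathrm{d}x\,\mathrm{d}y=\frac{1}{\pi\rho}e^{-(x^2+y^2)/\rho}\,\mathrm{d}x\,\mathrm{d}y$, and $L^2_{\mathbb{C}}(\mu)$ is the space of complex-valued square-integrable functions. As an operator in $L^2_{\mathbb{C}}(\mu)$, $A$ is the generator of the Ornstein-Uhlenbeck semigroup $P_t=e^{tA}$, $P_t\varphi(x)=\frac{1}{\pi\rho(1-e^{-2rt})}\int_{\mathbb{R}^2}e^{-\frac{|y|^2}{\rho(1-e^{-2rt})}}\varphi(e^{tB}x-y)\,\mathrm{d}y$ for $t>0$, with $B=\begin{bmatrix}-r&\Omega\\-\Omega&-r\end{bmatrix}$; on polynomials it acts by the displayed differential expression. The Laguerre polynomials with parameter $\rho$ are defined, for real $\alpha>-1$, by $L_0^\alpha=1$ and $L_n^{\alpha}(x,\rho)=\frac{\rho^n}{n!}x^{-\alpha}e^{x/\rho}\frac{\mathrm{d}^n}{\mathrm{d}x^n}\big(e^{-x/\rho}x^{n+\alpha}\big)$, $n\ge 1$; equivalently $L_n^{\alpha}(x,\rho)=\frac{(-1)^n}{n!}\sum_{k=0}^n(-1)^k k!\binom{n+\alpha}{k}\binom{n}{k}x^{n-k}\rho^k$. *)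

theory Defs
  imports "HOL-Analysis.Analysis"
begin

section \<open>The Ornstein-Uhlenbeck semigroup and its generator\<close>

text \<open>
  The measure \<open>\<mu>\<close>, written with \<open>\<rho> = 2\<sigma>\<^sup>2/r\<close>. Elements of the complex space \<open>L\<^sup>2(\<mu>)\<close> are
  represented by Borel functions on the plane, and identified when they agree \<open>\<mu>\<close>-almost everywhere.
\<close>

definition ou_measure :: "real \<Rightarrow> (real \<times> real) measure" where
  "ou_measure \<rho> =
     density lborel (\<lambda>(x, y). ennreal (1 / (pi * \<rho>) * exp (- (x\<^sup>2 + y\<^sup>2) / \<rho>)))"

definition L2_mu :: "real \<Rightarrow> (real \<times> real \<Rightarrow> complex) set" where
  "L2_mu \<rho> = {f. f \<in> borel_measurable (ou_measure \<rho>) \<and>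
                  integrable (ou_measure \<rho>) (\<lambda>p. (cmod (f p))\<^sup>2)}"

definition drift :: "real \<Rightarrow> real \<Rightarrow> real \<times> real \<Rightarrow> real \<times> real" where
  "drift r \<Omega> = (\<lambda>(x, y). (- r * x + \<Omega> * y, - \<Omega> * x - r * y))"

text \<open>\<open>e\<^bsup>tB\<^esup> p\<close> as the exponential series of a linear map \<open>B\<close>, applied to a point.\<close>

definition exp_flow :: "(real \<times> real \<Rightarrow> real \<times> real) \<Rightarrow> real \<Rightarrow> real \<times> real \<Rightarrow> real \<times> real" where
  "exp_flow B t p = (\<Sum>k. (t ^ k / fact k) *\<^sub>R (B ^^ k) p)"

text \<open>
  Used only for \<open>t > 0\<close> and \<open>\<phi>\<close> in \<open>L\<^sup>2(\<mu>)\<close>. There the integral converges absolutely at every point,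
  and it depends only on the almost-everywhere class of \<open>\<phi>\<close>.
\<close>

definition ou_semigroup ::
  "real \<Rightarrow> real \<Rightarrow> real \<Rightarrow> real \<Rightarrow> (real \<times> real \<Rightarrow> complex) \<Rightarrow> real \<times> real \<Rightarrow> complex" where
  "ou_semigroup r \<Omega> \<rho> t \<phi> p =
     (1 / (pi * \<rho> * (1 - exp (- 2 * r * t)))) *\<^sub>R
       (LINT q|lborel. exp (- (norm q)\<^sup>2 / (\<rho> * (1 - exp (- 2 * r * t)))) *\<^sub>R
          \<phi> (exp_flow (drift r \<Omega>) t p - q))"

text \<open>
  The graph of the generator: \<open>f\<close> is in the domain of \<open>A\<close> and \<open>A f = g\<close>, that is,
  \<open>(P\<^sub>t f - f) / t\<close> tends to \<open>g\<close> in \<open>L\<^sup>2(\<mu>)\<close> as \<open>t\<close> decreases to \<open>0\<close>.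
\<close>

definition ou_generator ::
  "real \<Rightarrow> real \<Rightarrow> real \<Rightarrow> (real \<times> real \<Rightarrow> complex) \<Rightarrow> (real \<times> real \<Rightarrow> complex) \<Rightarrow> bool" where
  "ou_generator r \<Omega> \<rho> f g \<longleftrightarrow>
     f \<in> L2_mu \<rho> \<and> g \<in> L2_mu \<rho> \<and>
     ((\<lambda>t. \<integral>\<^sup>+ p. ennreal ((cmod ((ou_semigroup r \<Omega> \<rho> t f p - f p) /\<^sub>R t - g p))\<^sup>2) \<partial>ou_measure \<rho>)
        \<longlongrightarrow> 0) (at_right 0)"

definition ou_eigenfunction ::
  "real \<Rightarrow> real \<Rightarrow> real \<Rightarrow> complex \<Rightarrow> (real \<times> real \<Rightarrow> complex) \<Rightarrow> bool" where
  "ou_eigenfunction r \<Omega> \<rho> ev f \<longleftrightarrow>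
     \<not> (AE p in ou_measure \<rho>. f p = 0) \<and> ou_generator r \<Omega> \<rho> f (\<lambda>p. ev * f p)"

definition d_dx :: "(real \<times> real \<Rightarrow> complex) \<Rightarrow> real \<times> real \<Rightarrow> complex" where
  "d_dx f = (\<lambda>(x, y). vector_derivative (\<lambda>s. f (s, y)) (at x))"

definition d_dy :: "(real \<times> real \<Rightarrow> complex) \<Rightarrow> real \<times> real \<Rightarrow> complex" where
  "d_dy f = (\<lambda>(x, y). vector_derivative (\<lambda>s. f (x, s)) (at y))"

text \<open>The differential expression by which the generator acts on polynomials.\<close>

definition ou_diff_op ::
  "real \<Rightarrow> real \<Rightarrow> real \<Rightarrow> (real \<times> real \<Rightarrow> complex) \<Rightarrow> real \<times> real \<Rightarrow> complex" where
  "ou_diff_op r \<sigma> \<Omega> f = (\<lambda>(x, y).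
     (- r * x + \<Omega> * y) *\<^sub>R d_dx f (x, y) + (- \<Omega> * x - r * y) *\<^sub>R d_dy f (x, y)
     + \<sigma>\<^sup>2 *\<^sub>R (d_dx (d_dx f) (x, y) + d_dy (d_dy f) (x, y)))"


section \<open>Laguerre polynomials with a parameter\<close>

text \<open>
  The explicit polynomial form is taken as the definition, because the Rodrigues formula does not
  make sense at \<open>x = 0\<close>; lemma \<open>laguerre_rodrigues\<close> below shows that the two agree for \<open>x > 0\<close>.
\<close>

definition laguerre :: "nat \<Rightarrow> real \<Rightarrow> real \<Rightarrow> real \<Rightarrow> real" where
  "laguerre n \<alpha> x \<rho> = (- 1) ^ n / fact n *
     (\<Sum>k = 0..n. (- 1) ^ k * fact k * ((real n + \<alpha>) gchoose k) * real (n choose k)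
                    * x ^ (n - k) * \<rho> ^ k)"

definition J :: "real \<Rightarrow> nat \<Rightarrow> nat \<Rightarrow> real \<times> real \<Rightarrow> complex" where
  "J \<rho> m n = (\<lambda>(x, y).
     if m \<ge> n then
       (- 1) ^ n * fact n * (complex_of_real x + \<i> * complex_of_real y) ^ (m - n)
         * complex_of_real (laguerre n (real (m - n)) (x\<^sup>2 + y\<^sup>2) \<rho>)
     else
       (- 1) ^ m * fact m * (complex_of_real x - \<i> * complex_of_real y) ^ (n - m)
         * complex_of_real (laguerre m (real (n - m)) (x\<^sup>2 + y\<^sup>2) \<rho>))"

lemma pascal_sum:
  fixes w :: "nat \<Rightarrow> nat \<Rightarrow> real"
  shows "(\<Sum>k\<le>j. real (j choose k) * (w (Suc (j - k)) k + w (j - k) (Suc k))) =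
         (\<Sum>k\<le>Suc j. real (Suc j choose k) * w (Suc j - k) k)"
proof -
  have "(\<Sum>k\<le>Suc j. real (Suc j choose k) * w (Suc j - k) k) =
      w (Suc j) 0 + (\<Sum>k\<le>j. real (Suc j choose Suc k) * w (j - k) (Suc k))"
    by (subst sum.atMost_Suc_shift) simp
  also have "\<dots> = (w (Suc j) 0 + (\<Sum>k\<le>j. real (j choose Suc k) * w (j - k) (Suc k))) +
      (\<Sum>k\<le>j. real (j choose k) * w (j - k) (Suc k))"
    by (simp add: algebra_simps sum.distrib)
  also have "w (Suc j) 0 + (\<Sum>k\<le>j. real (j choose Suc k) * w (j - k) (Suc k)) =
      (\<Sum>k\<le>Suc j. real (j choose k) * w (Suc j - k) k)"
    by (subst sum.atMost_Suc_shift) simp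
  also have "\<dots> = (\<Sum>k\<le>j. real (j choose k) * w (Suc (j - k)) k)"
    by (simp add: Suc_diff_le)
  finally show ?thesis
    by (simp add: algebra_simps sum.distrib)
qed

lemma higher_deriv_exp_powr:
  fixes \<rho> a x :: real
  assumes "\<rho> \<noteq> 0" "x > 0"
  shows "(deriv ^^ j) (\<lambda>u. exp (- u / \<rho>) * u powr a) x =
    exp (- x / \<rho>) * (\<Sum>k\<le>j. real (j choose k) *
      ((- 1 / \<rho>) ^ (j - k) * (fact k * (a gchoose k)) * x powr (a - real k)))"
  using assms(2)
proof (induction j arbitrary: x)
  case 0
  then show ?case by simp
next
  case (Suc j)
  let ?P = "\<lambda>k. fact k * (a gchoose k)"
  have P: "?P (Suc k) = ?P k * (a - real k)" for k
    by (simp add: gbinomial_prod_rev)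
  let ?G = "\<lambda>x. exp (- x / \<rho>) * (\<Sum>k\<le>j. real (j choose k) *
      ((- 1 / \<rho>) ^ (j - k) * ?P k * x powr (a - real k)))"
  let ?w = "\<lambda>i k. (- 1 / \<rho>) ^ i * ?P k * x powr (a - real k)"
  have "eventually (\<lambda>u. u \<in> {0<..}) (nhds x)"
    using Suc.prems by (intro eventually_nhds_in_open) auto
  then have "eventually (\<lambda>u. (deriv ^^ j) (\<lambda>u. exp (- u / \<rho>) * u powr a) u = ?G u) (nhds x)"
    by eventually_elim (use Suc.IH in auto)
  then have "(deriv ^^ Suc j) (\<lambda>u. exp (- u / \<rho>) * u powr a) x = deriv ?G x"
    by (simp add: deriv_cong_ev)
  also have "\<dots> = (- 1 / \<rho>) * ?G x + exp (- x / \<rho>) * (\<Sum>k\<le>j. real (j choose k) *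
      ((- 1 / \<rho>) ^ (j - k) * ?P k * ((a - real k) * x powr (a - real k - 1))))"
    using Suc.prems assms(1)
    by (intro DERIV_imp_deriv)
      (auto intro!: derivative_eq_intros DERIV_cong[OF has_real_derivative_powr] sum.cong)
  also have "\<dots> = exp (- x / \<rho>) * (\<Sum>k\<le>j. (- 1 / \<rho>) * (real (j choose k) * ?w (j - k) k) +
      real (j choose k) * ((- 1 / \<rho>) ^ (j - k) * ?P k * ((a - real k) * x powr (a - real k - 1))))"
    unfolding sum.distrib sum_distrib_left[symmetric] by (simp only: distrib_left mult.left_commute)
  also have "\<dots> = exp (- x / \<rho>) * (\<Sum>k\<le>j. real (j choose k) * (?w (Suc (j - k)) k + ?w (j - k) (Suc k)))"
  proof -
    have "a - real (Suc k) = a - real k - 1" for k by simp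
    then show ?thesis by (simp only: P power_Suc distrib_left mult_ac)
  qed
  also have "\<dots> = exp (- x / \<rho>) * (\<Sum>k\<le>Suc j. real (Suc j choose k) * ?w (Suc j - k) k)"
    by (subst pascal_sum) rule
  finally show ?case .
qed

lemma laguerre_rodrigues:
  fixes \<rho> \<alpha> x :: real
  assumes "\<rho> \<noteq> 0" "x > 0"
  shows "laguerre n \<alpha> x \<rho> = \<rho> ^ n / fact n * x powr (- \<alpha>) * exp (x / \<rho>) *
           (deriv ^^ n) (\<lambda>u. exp (- u / \<rho>) * u powr (real n + \<alpha>)) x"
proof -
  have "\<rho> ^ n * x powr (- \<alpha>) *
      ((- 1 / \<rho>) ^ (n - k) * (fact k * ((real n + \<alpha>) gchoose k)) * x powr (real n + \<alpha> - real k)) =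
      (- 1) ^ n * ((- 1) ^ k * fact k * ((real n + \<alpha>) gchoose k) * x ^ (n - k) * \<rho> ^ k)"
    if "k \<le> n" for k
  proof -
    have "x powr (- \<alpha>) * x powr (real n + \<alpha> - real k) = x ^ (n - k)"
      using assms that by (simp flip: powr_add powr_realpow add: of_nat_diff)
    moreover have "\<rho> ^ n * (- 1 / \<rho>) ^ (n - k) = (- 1) ^ n * (- 1) ^ k * \<rho> ^ k"
    proof -
      obtain d where n: "n = k + d" using \<open>k \<le> n\<close> le_Suc_ex by blast
      have "\<rho> ^ d * (- 1 / \<rho>) ^ d = (- 1) ^ d"
        using assms(1) by (simp flip: power_mult_distrib)
      moreover have "(- 1 :: real) ^ n * (- 1) ^ k = (- 1) ^ d"
        by (simp add: n power_add flip: power_mult_distrib)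
      ultimately show ?thesis by (simp add: n power_add mult.assoc)
    qed
    moreover have "R * X * (Q * (fact k * b) * Y) = s * (t * fact k * b * z * u)"
      if "X * Y = z" "R * Q = s * t * u" for R X Q b Y z s t u :: real
    proof -
      have "R * X * (Q * (fact k * b) * Y) = (R * Q) * (fact k * b) * (X * Y)"
        by (simp only: mult_ac)
      also have "\<dots> = s * (t * fact k * b * z * u)"
        unfolding that by (simp only: mult_ac)
      finally show ?thesis .
    qed
    ultimately show ?thesis by blast
  qed
  note summand = this
  have "\<rho> ^ n / fact n * x powr (- \<alpha>) * exp (x / \<rho>) *
      (deriv ^^ n) (\<lambda>u. exp (- u / \<rho>) * u powr (real n + \<alpha>)) x =
      (exp (x / \<rho>) * exp (- x / \<rho>)) * (\<Sum>k\<le>n. real (n choose k) * (\<rho> ^ n * x powr (- \<alpha>) *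
        ((- 1 / \<rho>) ^ (n - k) * (fact k * ((real n + \<alpha>) gchoose k)) * x powr (real n + \<alpha> - real k)))) / fact n"
    unfolding higher_deriv_exp_powr[OF assms]
    by (simp add: sum_distrib_left sum_divide_distrib mult_ac)
  also have "exp (x / \<rho>) * exp (- x / \<rho>) = 1"
    by (simp flip: exp_add)
  also have "1 * (\<Sum>k\<le>n. real (n choose k) * (\<rho> ^ n * x powr (- \<alpha>) *
        ((- 1 / \<rho>) ^ (n - k) * (fact k * ((real n + \<alpha>) gchoose k)) * x powr (real n + \<alpha> - real k)))) =
      (\<Sum>k\<le>n. real (n choose k) *
        ((- 1) ^ n * ((- 1) ^ k * fact k * ((real n + \<alpha>) gchoose k) * x ^ (n - k) * \<rho> ^ k)))"
    unfolding mult_1 by (intro sum.cong refl arg_cong2[where f = "(*)"] summand) simp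
  finally show ?thesis
    by (simp add: laguerre_def atMost_atLeast0 sum_distrib_left sum_divide_distrib mult_ac)
qed

end

theory Submission
  imports Defs "HOL-Probability.Probability"
begin

text \<open>
  In the variables \<open>z = x + \<i>y\<close> and \<open>w = x - \<i>y\<close> the function \<open>J\<close> is the complex Hermite polynomial
  \<open>exp (\<tau> \<partial>\<^sub>z \<partial>\<^sub>w) (z\<^sup>m w\<^sup>n)\<close> at \<open>\<tau> = - \<rho>\<close>. Averaging against a centred Gaussian of variance \<open>s\<close> replaces \<open>\<tau>\<close> by
  \<open>\<tau> + s\<close>, and \<open>e\<^bsup>tB\<^esup>\<close> multiplies \<open>z\<close> by a complex number, so \<open>P\<^sub>t J = e\<^bsup>\<lambda>t\<^esup> J\<close>.

  For uniqueness, the adjoint of \<open>P\<^sub>t\<close> is the semigroup with \<open>\<Omega>\<close> replaced by \<open>- \<Omega>\<close>. Since \<open>\<Omega> \<noteq> 0\<close>, the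
  eigenvalues are pairwise distinct, hence an eigenfunction minus its projection \<open>c J\<close> is a function \<open>h\<close>
  orthogonal to all polynomials. The kernel of \<open>P\<^sub>t\<close>, relative to \<open>\<mu>\<close>, is a constant times
  \<open>exp (- a|q|\<^sup>2 + \<alpha>z + \<beta>w)\<close> with \<open>a \<ge> 0\<close>. Expanding the exponentials in power series gives \<open>P\<^sub>t h = 0\<close> for
  all \<open>t > 0\<close>; as \<open>h\<close> lies in the domain of the generator, \<open>P\<^sub>t h \<rightarrow> h\<close>, so \<open>h = 0\<close>.
\<close>

section \<open>Complex Hermite polynomials\<close>

text \<open>The pairing between functions is bilinear: the integral of \<open>f * g\<close> without
  conjugation. The transposed kernel is then again an Ornstein-Uhlenbeck kernel, and the partner of
  \<open>J \<rho> m n\<close> is its conjugate \<open>J \<rho> n m\<close>. The parameter \<tau> =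
  -\<rho> is singled out because the Gaussian shift by s = \<rho>(1 - exp(-2rt)) gives -\<rho> + s =
  -\<rho> exp(-2rt), which is what the contraction of the plane by exp(-rt) does to \<tau>. The
  coefficients of \<open>cherm\<close> come from \<tau>^k / k! times the k-th derivatives of z^a and
  w^b. In the uniqueness half the obstacle is that \<open>h\<close> is merely square integrable,
  while the Gaussian exponent a = 1/s - 1/\<rho> is unbounded as t decreases to 0. Every expansion
  needs a majorant in \<open>L\<^sup>2(\<mu>)\<close>, which admits exp(\<delta>|q|^2) only for
  \<delta> < 1/(2\<rho>). The budget is fixed at \<delta> = 1/(4\<rho>), which leaves room for
  powers and for exponentials of linear growth. The constants \<alpha> and \<beta> are the conjugate
  of e and e itself, divided by s, where e is the point exp(tB)p read as a complex number.\<close>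

definition cherm :: "complex \<Rightarrow> nat \<Rightarrow> nat \<Rightarrow> complex \<Rightarrow> complex \<Rightarrow> complex" where
  "cherm \<tau> a b z w =
     (\<Sum>k\<le>min a b. fact k * of_nat (a choose k) * of_nat (b choose k) * \<tau> ^ k * z ^ (a - k) * w ^ (b - k))"

text \<open>Beyond \<open>min a b\<close> one of the two binomials is 0. Sums with neighbouring
  indices can therefore share one upper limit and be compared term by term.\<close>

lemma cherm_eq_sum:
  assumes "min a b \<le> n"
  shows "cherm \<tau> a b z w =
    (\<Sum>k\<le>n. fact k * of_nat (a choose k) * of_nat (b choose k) * \<tau> ^ k * z ^ (a - k) * w ^ (b - k))"
  unfolding cherm_def using assms
  by (intro sum.mono_neutral_left) (auto simp: not_le min_less_iff_disj)

lemma cherm_swap: "cherm \<tau> a b z w = cherm \<tau> b a w z"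
  unfolding cherm_def by (simp add: min.commute mult_ac)

lemma cnj_cherm: "cnj (cherm \<tau> a b z w) = cherm (cnj \<tau>) a b (cnj z) (cnj w)"
  unfolding cherm_def by (simp add: cnj_sum)

lemma cherm_0_left [simp]: "cherm \<tau> 0 b z w = w ^ b"
  by (simp add: cherm_def)

text \<open>This is the commutation of exp(\<tau> d_z d_w) with multiplication by z, which becomes z
  + \<tau> d_w. Together with the value at a = 0 it determines the whole family, so later identities
  are proved by induction along it. At b = 0 the truncated \<open>b - 1\<close> is harmless because
  of the factor \<open>of_nat b\<close>.\<close>

lemma cherm_Suc_left:
  "cherm \<tau> (Suc a) b z w = z * cherm \<tau> a b z w + \<tau> * of_nat b * cherm \<tau> a (b - 1) z w"
proof -
  define N where "N = a + b"
  let ?t = "\<lambda>a b k. fact k * of_nat (a choose k) * of_nat (b choose k) * \<tau> ^ k * z ^ (a - k) * w ^ (b - k)"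
  have 1: "?t (Suc a) b (Suc k) = z * ?t a b (Suc k) + \<tau> * of_nat b * ?t a (b - 1) k" for k
  proof -
    have A: "of_nat (a choose Suc k) * z ^ (Suc a - Suc k) = z * (of_nat (a choose Suc k) * z ^ (a - Suc k))"
    proof (cases "Suc k \<le> a")
      case True
      then have "Suc a - Suc k = Suc (a - Suc k)" by simp
      then show ?thesis by simp
    qed simp
    \<comment> \<open>Absorption: the factor k + 1 of the factorial lowers b by one. Pascal's rule
      acts on the other binomial, and its two parts give the two terms of the recurrence.\<close>
    have B: "of_nat (Suc k) * of_nat (b choose Suc k) * w ^ (b - Suc k)
      = of_nat b * (of_nat ((b - 1) choose k) * w ^ (b - 1 - k) :: complex)"
    proof (cases b)
      case (Suc b')
      have "(of_nat (Suc k) * of_nat (Suc b' choose Suc k) :: complex) = of_nat (Suc b') * of_nat (b' choose k)"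
        by (metis Suc_times_binomial of_nat_mult)
      then show ?thesis using Suc by simp
    qed simp
    have "?t (Suc a) b (Suc k) = fact k * \<tau> ^ Suc k *
        (of_nat (a choose k) * z ^ (Suc a - Suc k) + of_nat (a choose Suc k) * z ^ (Suc a - Suc k))
        * (of_nat (Suc k) * of_nat (b choose Suc k) * w ^ (b - Suc k))"
      by (simp add: algebra_simps)
    also have "\<dots> = \<tau> * of_nat b * ?t a (b - 1) k + fact k * \<tau> ^ Suc k *
        (z * (of_nat (a choose Suc k) * z ^ (a - Suc k)))
        * (of_nat (Suc k) * of_nat (b choose Suc k) * w ^ (b - Suc k))"
      unfolding distrib_left distrib_right A by (subst B) (simp add: mult_ac)
    also have "\<dots> = \<tau> * of_nat b * ?t a (b - 1) k + z * ?t a b (Suc k)"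
      by (simp add: algebra_simps)
    finally show ?thesis by simp
  qed
  have "cherm \<tau> (Suc a) b z w = (\<Sum>k\<le>Suc N. ?t (Suc a) b k)"
    by (rule cherm_eq_sum) (simp add: N_def)
  also have "\<dots> = ?t (Suc a) b 0 + (\<Sum>k\<le>N. ?t (Suc a) b (Suc k))"
    by (rule sum.atMost_Suc_shift)
  also have "\<dots> = z * (?t a b 0 + (\<Sum>k\<le>N. ?t a b (Suc k))) + \<tau> * of_nat b * (\<Sum>k\<le>N. ?t a (b - 1) k)"
    unfolding 1 by (simp add: sum.distrib sum_distrib_left distrib_left mult_ac)
  also have "?t a b 0 + (\<Sum>k\<le>N. ?t a b (Suc k)) = (\<Sum>k\<le>Suc N. ?t a b k)"
    by (rule sum.atMost_Suc_shift[symmetric])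
  also have "\<dots> = cherm \<tau> a b z w"
    by (rule cherm_eq_sum[symmetric]) (simp add: N_def)
  also have "(\<Sum>k\<le>N. ?t a (b - 1) k) = cherm \<tau> a (b - 1) z w"
    by (rule cherm_eq_sum[symmetric]) (simp add: N_def)
  finally show ?thesis .
qed

lemma cherm_Suc_right:
  "cherm \<tau> a (Suc b) z w = w * cherm \<tau> a b z w + \<tau> * of_nat a * cherm \<tau> (a - 1) b z w"
  by (subst (1 2 3) cherm_swap) (rule cherm_Suc_left)

text \<open>The recurrence solved for z d_z applied to a Hermite polynomial: the degree a appears as
  eigenvalue, up to a correction by the mixed second derivative. Keeping the factor
  \<open>of_nat a\<close> makes a = 0 trivial.\<close>

lemma of_nat_mult_cherm_left:
  "of_nat a * (z * cherm \<tau> (a - 1) b z w) =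
     of_nat a * (cherm \<tau> a b z w - \<tau> * of_nat b * cherm \<tau> (a - 1) (b - 1) z w)"
  by (cases a) (simp_all add: cherm_Suc_left)

lemma of_nat_mult_cherm_right:
  "of_nat b * (w * cherm \<tau> a (b - 1) z w) =
     of_nat b * (cherm \<tau> a b z w - \<tau> * of_nat a * cherm \<tau> (a - 1) (b - 1) z w)"
  by (cases b) (simp_all add: cherm_Suc_right)

text \<open>The Appell property, that d_z lowers a with factor a and d_w lowers b with factor b,
  combined with the chain rule. Allowing arbitrary curves makes both partial derivatives, and those
  of the reflected argument p - q, instances of one statement.\<close>

lemma has_vector_derivative_cherm:
  fixes z w :: "real \<Rightarrow> complex"
  assumes z: "(z has_vector_derivative z') (at x)" and w: "(w has_vector_derivative w') (at x)"
  shows "((\<lambda>x. cherm \<tau> a b (z x) (w x)) has_vector_derivative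
     (z' * (of_nat a * cherm \<tau> (a - 1) b (z x) (w x)) + w' * (of_nat b * cherm \<tau> a (b - 1) (z x) (w x)))) (at x)"
proof (induction a arbitrary: b)
  case 0
  have "((\<lambda>v. v ^ b) has_field_derivative of_nat b * w x ^ (b - 1)) (at (w x))"
    by (auto intro!: derivative_eq_intros)
  from field_vector_diff_chain_at[OF w this]
  have "((\<lambda>x. w x ^ b) has_vector_derivative (of_nat b * w x ^ (b - 1)) * w') (at x)"
    by (simp add: o_def mult_ac)
  then show ?case by (simp add: mult_ac)
next
  case (Suc a)
  have "z' * cherm \<tau> a b (z x) (w x)
     + z x * (z' * (of_nat a * cherm \<tau> (a - 1) b (z x) (w x)) + w' * (of_nat b * cherm \<tau> a (b - 1) (z x) (w x)))
     + \<tau> * of_nat b * (z' * (of_nat a * cherm \<tau> (a - 1) (b - 1) (z x) (w x)) +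
          w' * (of_nat (b - 1) * cherm \<tau> a (b - 1 - 1) (z x) (w x)))
    = z' * (cherm \<tau> a b (z x) (w x) + of_nat a * (z x * cherm \<tau> (a - 1) b (z x) (w x))
             + of_nat a * (\<tau> * of_nat b * cherm \<tau> (a - 1) (b - 1) (z x) (w x)))
      + w' * (of_nat b * (z x * cherm \<tau> a (b - 1) (z x) (w x) + \<tau> * of_nat (b - 1) * cherm \<tau> a (b - 1 - 1) (z x) (w x)))"
    by (simp add: algebra_simps)
  also have "\<dots> = z' * (of_nat (Suc a) * cherm \<tau> a b (z x) (w x)) +
       w' * (of_nat b * cherm \<tau> (Suc a) (b - 1) (z x) (w x))"
    unfolding of_nat_mult_cherm_left cherm_Suc_left by (simp add: algebra_simps)
  \<comment> \<open>Oriented so that it rewrites the claimed derivative into the shape that the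
    product rule produces from the recurrence.\<close>
  finally have eq: "\<dots> = z' * cherm \<tau> a b (z x) (w x)
     + z x * (z' * (of_nat a * cherm \<tau> (a - 1) b (z x) (w x)) + w' * (of_nat b * cherm \<tau> a (b - 1) (z x) (w x)))
     + \<tau> * of_nat b * (z' * (of_nat a * cherm \<tau> (a - 1) (b - 1) (z x) (w x)) +
          w' * (of_nat (b - 1) * cherm \<tau> a (b - 1 - 1) (z x) (w x)))" ..
  show ?case
    unfolding cherm_Suc_left[of \<tau> a] diff_Suc_1
    unfolding eq[unfolded cherm_Suc_left[of \<tau> a]]
    by (rule derivative_eq_intros z Suc.IH refl)+ (simp add: algebra_simps)
qed

text \<open>Weighted homogeneity: each power of \<tau> stands for one lost factor z and one lost
  factor w, so \<tau> carries the weight u * v.\<close>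

lemma cherm_scale:
  assumes "u * v = (\<kappa> :: complex)"
  shows "cherm (\<kappa> * \<tau>) a b (u * z) (v * w) = u ^ a * v ^ b * cherm \<tau> a b z w"
proof (induction a arbitrary: b)
  case 0
  then show ?case by (simp add: power_mult_distrib)
next
  case (Suc a)
  then show ?case
    by (cases b) (auto simp: cherm_Suc_left algebra_simps simp flip: assms)
qed

section \<open>The plane as the complex line, and Laguerre functions as Hermite polynomials\<close>

definition cplx :: "real \<times> real \<Rightarrow> complex" where
  "cplx p = Complex (fst p) (snd p)"

lemma cplx_Pair: "cplx (x, y) = complex_of_real x + \<i> * complex_of_real y"
  by (simp add: cplx_def complex_eq_iff)

lemma cplx_diff: "cplx (p - q) = cplx p - cplx q"
  by (simp add: cplx_def complex_eq_iff)

lemma norm_cplx [simp]: "cmod (cplx p) = norm p"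
  by (cases p) (simp add: cplx_def cmod_def norm_Pair)

lemma bounded_linear_cplx: "bounded_linear cplx"
  by (rule bounded_linear_intro[where K = 1]) (auto simp: cplx_def complex_eq_iff norm_prod_def cmod_def)

lemma continuous_on_cplx [continuous_intros]:
  "continuous_on S f \<Longrightarrow> continuous_on S (\<lambda>x. cplx (f x))"
  using bounded_linear.continuous_on[OF bounded_linear_cplx] .

lemma borel_measurable_cplx [measurable]: "cplx \<in> borel_measurable borel"
  by (intro borel_measurable_continuous_onI continuous_intros)

abbreviation planeherm :: "complex \<Rightarrow> nat \<Rightarrow> nat \<Rightarrow> real \<times> real \<Rightarrow> complex" where
  "planeherm \<tau> a b p \<equiv> cherm \<tau> a b (cplx p) (cnj (cplx p))"

text \<open>With integer parameter m - n the generalized binomial is \<open>m choose k\<close>, and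
  the leftover power z^(m - n) completes (z w)^(n - k) to z^(m - k) w^(n - k). Since z and w are
  independent here, the case m < n of \<open>J\<close> follows by exchanging them.\<close>

lemma laguerre_term:
  fixes z w :: complex
  assumes "n \<le> m" "z * w = complex_of_real u"
  shows "(-1) ^ n * fact n * z ^ (m - n) * complex_of_real (laguerre n (real (m - n)) u \<rho>) =
    cherm (- complex_of_real \<rho>) m n z w"
proof -
  have "real n + real (m - n) = real m" using assms(1) by simp
  moreover have "(- 1) ^ n * fact n * ((- 1 :: real) ^ n / fact n * X) = X" for X
  proof -
    have "(-1::real) ^ n * (-1) ^ n = 1" by (simp flip: power_mult_distrib)
    then show ?thesis by simp
  qed
  ultimately have L: "(-1) ^ n * fact n * laguerre n (real (m - n)) u \<rho> =
     (\<Sum>k\<le>n. (- 1) ^ k * fact k * real (m choose k) * real (n choose k) * u ^ (n - k) * \<rho> ^ k)"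
    by (simp add: laguerre_def atMost_atLeast0 binomial_gbinomial)
  have "(-1) ^ n * fact n * z ^ (m - n) * complex_of_real (laguerre n (real (m - n)) u \<rho>) =
    z ^ (m - n) * complex_of_real ((-1) ^ n * fact n * laguerre n (real (m - n)) u \<rho>)"
    by simp
  also have "\<dots> = (\<Sum>k\<le>n. fact k * of_nat (m choose k) * of_nat (n choose k) * (- complex_of_real \<rho>) ^ k
       * (z ^ (m - n) * (z * w) ^ (n - k)))"
    unfolding L assms(2)
    by (simp add: sum_distrib_left power_minus[of "complex_of_real \<rho>"] mult_ac)
  also have "\<dots> = cherm (- complex_of_real \<rho>) m n z w"
    unfolding cherm_eq_sum[of m n n, OF min.cobounded2]
  proof (intro sum.cong refl)
    fix k assume "k \<in> {..n}"
    then have "m - k = (m - n) + (n - k)" using assms(1) by simp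
    then have "z ^ (m - n) * (z * w) ^ (n - k) = z ^ (m - k) * w ^ (n - k)"
      by (simp add: power_add power_mult_distrib)
    then show "fact k * of_nat (m choose k) * of_nat (n choose k) * (- complex_of_real \<rho>) ^ k
       * (z ^ (m - n) * (z * w) ^ (n - k)) = fact k * of_nat (m choose k) * of_nat (n choose k) *
       (- complex_of_real \<rho>) ^ k * z ^ (m - k) * w ^ (n - k)"
      by (simp add: mult.assoc)
  qed
  finally show ?thesis .
qed

lemma J_eq_planeherm: "J \<rho> m n = planeherm (- complex_of_real \<rho>) m n"
proof
  fix p :: "real \<times> real"
  obtain x y where p: "p = (x, y)" by force
  let ?z = "complex_of_real x + \<i> * complex_of_real y"
  have c: "cnj ?z = complex_of_real x - \<i> * complex_of_real y" by simp
  have "?z * cnj ?z = complex_of_real (x\<^sup>2 + y\<^sup>2)"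
    by (simp add: complex_eq_iff power2_eq_square)
  then show "J \<rho> m n p = planeherm (- complex_of_real \<rho>) m n p"
    using laguerre_term[of n m ?z "cnj ?z" "x\<^sup>2 + y\<^sup>2" \<rho>] laguerre_term[of m n "cnj ?z" "?z" "x\<^sup>2 + y\<^sup>2" \<rho>]
    by (auto simp: J_def p cplx_Pair c mult.commute cherm_swap[of _ n m] simp del: complex_cnj_add)
qed

lemma has_vector_derivative_planeherm_fst:
  "((\<lambda>s. planeherm \<tau> a b (s, y)) has_vector_derivative
     (of_nat a * planeherm \<tau> (a - 1) b (x, y) + of_nat b * planeherm \<tau> a (b - 1) (x, y))) (at x)"
proof -
  have "((\<lambda>s. cplx (s, y)) has_vector_derivative 1) (at x)"
       "((\<lambda>s. cnj (cplx (s, y))) has_vector_derivative 1) (at x)"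
    unfolding cplx_Pair by (auto intro!: derivative_eq_intros)
  from has_vector_derivative_cherm[OF this] show ?thesis by simp
qed

lemma has_vector_derivative_planeherm_snd:
  "((\<lambda>s. planeherm \<tau> a b (x, s)) has_vector_derivative
     \<i> * (of_nat a * planeherm \<tau> (a - 1) b (x, y) - of_nat b * planeherm \<tau> a (b - 1) (x, y))) (at y)"
proof -
  have "((\<lambda>s. cplx (x, s)) has_vector_derivative \<i>) (at y)"
       "((\<lambda>s. cnj (cplx (x, s))) has_vector_derivative - \<i>) (at y)"
    unfolding cplx_Pair by (auto intro!: derivative_eq_intros)
  from has_vector_derivative_cherm[OF this] show ?thesis by (simp add: algebra_simps)
qed

text \<open>In Wirtinger form the drift is -\<theta> z d_z - cnj \<theta> w d_w with \<theta> = r +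
  i\<Omega>, and the Laplacian is 4 d_z d_w. The recurrences turn the drift into the eigenvalue plus
  2 r \<tau> d_z d_w; with \<tau> = -\<rho> and r\<rho> = 2\<sigma>^2 this remainder cancels the
  diffusion term.\<close>

lemma ou_diff_op_planeherm:
  assumes "r * \<rho> = 2 * \<sigma>\<^sup>2"
  shows "ou_diff_op r \<sigma> \<Omega> (planeherm (- complex_of_real \<rho>) a b) p =
    (- complex_of_real r * (of_nat a + of_nat b) - \<i> * (of_nat a - of_nat b) * complex_of_real \<Omega>) *
      planeherm (- complex_of_real \<rho>) a b p"
proof -
  obtain x y where p: "p = (x, y)" by force
  define \<tau> where "\<tau> = - complex_of_real \<rho>"
  let ?h = "\<lambda>a b. planeherm \<tau> a b (x, y)"
  have dx: "d_dx (planeherm \<tau> a b) =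
      (\<lambda>p. of_nat a * planeherm \<tau> (a - 1) b p + of_nat b * planeherm \<tau> a (b - 1) p)" for a b
    unfolding d_dx_def fun_eq_iff split_paired_All prod.case
    by (intro allI vector_derivative_at has_vector_derivative_planeherm_fst)
  have dy: "d_dy (planeherm \<tau> a b) =
      (\<lambda>p. \<i> * (of_nat a * planeherm \<tau> (a - 1) b p - of_nat b * planeherm \<tau> a (b - 1) p))" for a b
    unfolding d_dy_def fun_eq_iff split_paired_All prod.case
    by (intro allI vector_derivative_at has_vector_derivative_planeherm_snd)
  have dxx: "d_dx (d_dx (planeherm \<tau> a b)) (x, y) =
      of_nat a * (of_nat (a - 1) * ?h (a - 1 - 1) b + of_nat b * ?h (a - 1) (b - 1)) +
      of_nat b * (of_nat a * ?h (a - 1) (b - 1) + of_nat (b - 1) * ?h a (b - 1 - 1))"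
    unfolding dx unfolding d_dx_def prod.case
    by (intro vector_derivative_at derivative_intros has_vector_derivative_planeherm_fst)
  have dyy: "d_dy (d_dy (planeherm \<tau> a b)) (x, y) =
      \<i> * (of_nat a * (\<i> * (of_nat (a - 1) * ?h (a - 1 - 1) b - of_nat b * ?h (a - 1) (b - 1))) -
      of_nat b * (\<i> * (of_nat a * ?h (a - 1) (b - 1) - of_nat (b - 1) * ?h a (b - 1 - 1))))"
    unfolding dy unfolding d_dy_def prod.case
    by (intro vector_derivative_at derivative_intros has_vector_derivative_planeherm_snd)
  have laplace: "d_dx (d_dx (planeherm \<tau> a b)) (x, y) + d_dy (d_dy (planeherm \<tau> a b)) (x, y) =
      4 * of_nat a * of_nat b * ?h (a - 1) (b - 1)"
    unfolding dxx dyy by (simp add: algebra_simps del: of_nat_diff)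
  let ?z = "cplx (x, y)" and ?w = "cnj (cplx (x, y))"
  let ?\<theta> = "complex_of_real r + \<i> * complex_of_real \<Omega>"
  have "(- r * x + \<Omega> * y) *\<^sub>R d_dx (planeherm \<tau> a b) (x, y) +
        (- \<Omega> * x - r * y) *\<^sub>R d_dy (planeherm \<tau> a b) (x, y) =
     - ?\<theta> * (of_nat a * (?z * ?h (a - 1) b)) - cnj ?\<theta> * (of_nat b * (?w * ?h a (b - 1)))"
    unfolding dx dy by (simp add: scaleR_conv_of_real cplx_Pair algebra_simps)
  also have "\<dots> = - ?\<theta> * (of_nat a * (?h a b - \<tau> * of_nat b * ?h (a - 1) (b - 1)))
      - cnj ?\<theta> * (of_nat b * (?h a b - \<tau> * of_nat a * ?h (a - 1) (b - 1)))"
    unfolding of_nat_mult_cherm_left of_nat_mult_cherm_right ..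
  also have "\<dots> = (- complex_of_real r * (of_nat a + of_nat b) - \<i> * (of_nat a - of_nat b) * complex_of_real \<Omega>) * ?h a b
      - 2 * complex_of_real (r * \<rho>) * (of_nat a * of_nat b * ?h (a - 1) (b - 1))"
    unfolding \<tau>_def by (simp add: algebra_simps)
  finally show ?thesis
    unfolding ou_diff_op_def p prod.case \<tau>_def[symmetric] laplace assms
    by (simp add: scaleR_conv_of_real algebra_simps)
qed

section \<open>Gaussian averages\<close>

text \<open>Normalized so that the mean of |q|^2 is s; each coordinate has variance s/2. Both the
  density of \<mu> (s = \<rho>) and the transition kernel have this form.\<close>

definition gauss :: "real \<Rightarrow> real \<times> real \<Rightarrow> real" where
  "gauss s q = 1 / (pi * s) * exp (- (norm q)\<^sup>2 / s)"

lemma gauss_nonneg: "s > 0 \<Longrightarrow> 0 \<le> gauss s q"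
  by (simp add: gauss_def)

lemma gauss_pos: "s > 0 \<Longrightarrow> 0 < gauss s q"
  by (simp add: gauss_def)

lemma continuous_on_gauss [continuous_intros]:
  "continuous_on S f \<Longrightarrow> continuous_on S (\<lambda>x. gauss s (f x))"
  unfolding gauss_def divide_inverse by (intro continuous_intros)

lemma borel_measurable_gauss [measurable]: "gauss s \<in> borel_measurable borel"
  by (intro borel_measurable_continuous_onI continuous_intros)

lemma gauss_prod:
  assumes "s > 0"
  shows "gauss s (x, y) = normal_density 0 (sqrt (s / 2)) x * normal_density 0 (sqrt (s / 2)) y"
proof -
  have "sqrt (pi * s) * sqrt (pi * s) = pi * s" using assms by simp
  then show ?thesis
    using assms by (simp add: gauss_def normal_density_def norm_Pair diff_divide_distrib flip: exp_add)
qed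

lemma
  assumes "s > 0"
  shows integrable_gauss: "integrable lborel (gauss s)"
    and integral_gauss: "integral\<^sup>L lborel (gauss s) = 1"
proof -
  have "integrable (lborel \<Otimes>\<^sub>M lborel) (gauss s)"
    using assms by (intro lborel_pair.Fubini_integrable)
      (auto simp: gauss_prod lborel_prod abs_mult)
  then show "integrable lborel (gauss s)" "integral\<^sup>L lborel (gauss s) = 1"
    using lborel_pair.integral_fst'[of "gauss s"] assms by (simp_all add: lborel_prod gauss_prod)
qed

text \<open>Since 1 + v is at most exp v, the left side is at most exp((N + M) v); completing the
  square bounds it. It lets any power and any exponential of linear growth be paid for by an
  arbitrarily small part of a Gaussian exponent.\<close>

lemma power_exp_le_exp_square:
  fixes a M :: real
  assumes "a > 0" "v \<ge> 0"
  shows "(1 + v) ^ N * exp (M * v) \<le> exp ((real N + M)\<^sup>2 / (4 * a)) * exp (a * v\<^sup>2)"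
proof -
  have "(1 + v) ^ N \<le> exp v ^ N"
    using assms by (intro power_mono) auto
  then have "(1 + v) ^ N * exp (M * v) \<le> exp ((real N + M) * v)"
    by (simp add: exp_of_nat_mult[symmetric] exp_add distrib_right)
  also have "(real N + M) * v \<le> (real N + M)\<^sup>2 / (4 * a) + a * v\<^sup>2"
  proof -
    have "0 \<le> ((real N + M) / (2 * a) - v)\<^sup>2 * a" using assms by simp
    also have "\<dots> = (real N + M)\<^sup>2 / (4 * a) + a * v\<^sup>2 - (real N + M) * v"
      using assms by (simp add: power2_eq_square field_simps)
    finally show ?thesis by simp
  qed
  then have "exp ((real N + M) * v) \<le> exp ((real N + M)\<^sup>2 / (4 * a) + a * v\<^sup>2)" by simp
  finally show ?thesis by (simp add: exp_add)
qed

text \<open>A class closed under the operations needed for Hermite polynomials and reflected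
  arguments, so that integrability against Gaussians is checked once and not per polynomial.
  Continuity is included to supply measurability and closed zero sets.\<close>

definition poly_growth :: "(real \<times> real \<Rightarrow> complex) \<Rightarrow> bool" where
  "poly_growth f \<longleftrightarrow> continuous_on UNIV f \<and> (\<exists>C N. \<forall>q. cmod (f q) \<le> C * (1 + norm q) ^ N)"

lemma poly_growthE:
  assumes "poly_growth f"
  obtains C N where "C \<ge> 0" "\<And>q. cmod (f q) \<le> C * (1 + norm q) ^ N"
proof -
  obtain C N where CN: "\<And>q. cmod (f q) \<le> C * (1 + norm q) ^ N"
    using assms unfolding poly_growth_def by blast
  from CN[of 0] have "C \<ge> 0" by (simp add: order_trans[OF norm_ge_zero])
  with CN show thesis by (rule_tac that)
qed

lemma poly_growth_continuous_on:
  assumes "poly_growth f" "continuous_on S g"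
  shows "continuous_on S (\<lambda>x. f (g x))"
  using assms unfolding poly_growth_def by (blast intro: continuous_on_compose2[of UNIV])

lemma poly_growth_measurable [measurable_dest]: "poly_growth f \<Longrightarrow> f \<in> borel_measurable borel"
  unfolding poly_growth_def by (blast intro: borel_measurable_continuous_onI)

lemma poly_growth_const [intro]: "poly_growth (\<lambda>_. c)"
  unfolding poly_growth_def by (intro conjI continuous_on_const exI[of _ "cmod c"] exI[of _ 0]) simp

lemma poly_growth_cplx [intro]: "poly_growth cplx"
  unfolding poly_growth_def
  by (auto intro!: continuous_intros exI[of _ 1] exI[of _ "1::nat"])

lemma poly_growth_cnj [intro]: "poly_growth f \<Longrightarrow> poly_growth (\<lambda>q. cnj (f q))"
  unfolding poly_growth_def by (auto intro!: continuous_intros)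

lemma poly_growth_add [intro]:
  assumes "poly_growth f" "poly_growth g"
  shows "poly_growth (\<lambda>q. f q + g q)"
proof -
  obtain C N where f: "C \<ge> 0" "\<And>q. cmod (f q) \<le> C * (1 + norm q) ^ N"
    using assms(1) by (rule poly_growthE) blast
  obtain D M where g: "D \<ge> 0" "\<And>q. cmod (g q) \<le> D * (1 + norm q) ^ M"
    using assms(2) by (rule poly_growthE) blast
  have "cmod (f q + g q) \<le> (C + D) * (1 + norm q) ^ (N + M)" for q
  proof -
    have "cmod (f q) \<le> C * (1 + norm q) ^ (N + M)"
      using f by (intro order_trans[OF f(2)] mult_left_mono power_increasing) auto
    moreover have "cmod (g q) \<le> D * (1 + norm q) ^ (N + M)"
      using g by (intro order_trans[OF g(2)] mult_left_mono power_increasing) auto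
    ultimately show ?thesis
      using norm_triangle_ineq[of "f q" "g q"] by (simp add: distrib_right)
  qed
  with assms show ?thesis
    unfolding poly_growth_def by (blast intro: continuous_on_add)
qed

lemma poly_growth_mult [intro]:
  assumes "poly_growth f" "poly_growth g"
  shows "poly_growth (\<lambda>q. f q * g q)"
proof -
  obtain C N where f: "C \<ge> 0" "\<And>q. cmod (f q) \<le> C * (1 + norm q) ^ N"
    using assms(1) by (rule poly_growthE) blast
  obtain D M where g: "D \<ge> 0" "\<And>q. cmod (g q) \<le> D * (1 + norm q) ^ M"
    using assms(2) by (rule poly_growthE) blast
  have "cmod (f q * g q) \<le> (C * D) * (1 + norm q) ^ (N + M)" for q
    using mult_mono[OF f(2) g(2), of q q] f g by (simp add: norm_mult power_add mult_ac)
  with assms show ?thesis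
    unfolding poly_growth_def by (blast intro: continuous_on_mult)
qed

lemma poly_growth_power [intro]: "poly_growth f \<Longrightarrow> poly_growth (\<lambda>q. f q ^ n)"
  by (induction n) auto

lemma poly_growth_sum [intro]: "(\<And>i. i \<in> I \<Longrightarrow> poly_growth (f i)) \<Longrightarrow> poly_growth (\<lambda>q. \<Sum>i\<in>I. f i q)"
  by (induction I rule: infinite_finite_induct) auto

lemma poly_growth_cherm [intro]:
  "poly_growth f \<Longrightarrow> poly_growth g \<Longrightarrow> poly_growth (\<lambda>q. cherm \<tau> a b (f q) (g q))"
  unfolding cherm_def by (intro poly_growth_sum poly_growth_mult poly_growth_power poly_growth_const)

lemma poly_growth_diff [intro]: "poly_growth f \<Longrightarrow> poly_growth g \<Longrightarrow> poly_growth (\<lambda>q. f q - g q)"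
  using poly_growth_add[OF _ poly_growth_mult[OF poly_growth_const[of "-1"]], of f g] by simp

lemma poly_growth_minus [intro]: "poly_growth f \<Longrightarrow> poly_growth (\<lambda>q. - f q)"
  using poly_growth_diff[OF poly_growth_const[of 0]] by simp

lemma poly_growth_fst [intro]: "poly_growth (\<lambda>q. complex_of_real (fst q))"
proof -
  have "(\<lambda>q. complex_of_real (fst q)) = (\<lambda>q. (cplx q + cnj (cplx q)) * (1 / 2))"
    by (auto simp: cplx_def complex_eq_iff)
  moreover have "poly_growth \<dots>"
    by (intro poly_growth_mult poly_growth_add poly_growth_cnj poly_growth_cplx poly_growth_const)
  ultimately show ?thesis by simp
qed

lemma poly_growth_snd [intro]: "poly_growth (\<lambda>q. complex_of_real (snd q))"
proof -
  have "(\<lambda>q. complex_of_real (snd q)) = (\<lambda>q. (cplx q - cnj (cplx q)) * (- \<i> / 2))"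
    by (auto simp: cplx_def complex_eq_iff)
  moreover have "poly_growth \<dots>"
    by (intro poly_growth_mult poly_growth_diff poly_growth_cnj poly_growth_cplx poly_growth_const)
  ultimately show ?thesis by simp
qed

lemmas poly_growth_intros = poly_growth_const poly_growth_cplx poly_growth_fst poly_growth_snd
  poly_growth_cnj poly_growth_add poly_growth_diff poly_growth_minus poly_growth_mult
  poly_growth_power poly_growth_sum poly_growth_cherm

lemma one_plus_norm_diff_power_le:
  fixes w q :: "'a::real_normed_vector"
  shows "(1 + norm (w - q)) ^ N \<le> (1 + norm w) ^ N * (1 + norm q) ^ N"
proof -
  have "1 + norm (w - q) \<le> 1 + norm w + norm q"
    using norm_triangle_ineq4[of w q] by simp
  also have "\<dots> \<le> (1 + norm w) * (1 + norm q)"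
    by (simp add: algebra_simps)
  finally show ?thesis
    by (simp add: power_mono flip: power_mult_distrib)
qed

lemma poly_growth_reflect:
  assumes "poly_growth f"
  shows "poly_growth (\<lambda>q. f (w - q))"
proof -
  obtain C N where C: "C \<ge> 0" "\<And>q. cmod (f q) \<le> C * (1 + norm q) ^ N"
    using assms by (rule poly_growthE) blast
  have "cmod (f (w - q)) \<le> (C * (1 + norm w) ^ N) * (1 + norm q) ^ N" for q
    using order_trans[OF C(2) mult_left_mono[OF one_plus_norm_diff_power_le C(1)]]
    by (simp add: mult.assoc)
  then show ?thesis
    unfolding poly_growth_def by (auto intro!: poly_growth_continuous_on[OF assms] continuous_intros)
qed

lemma poly_growth_norm_power: "poly_growth (\<lambda>q. complex_of_real ((1 + norm q) ^ N))"
  unfolding poly_growth_def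
  by (intro conjI continuous_intros exI[of _ 1] exI[of _ N]) (simp del: of_real_power of_real_add)

text \<open>Half of the Gaussian exponent, 1/(2s), absorbs the polynomial; the other half is a
  Gaussian with parameter 2s. The 2 in the constant \<open>2 * C * D\<close> is the ratio of the two
  normalizations.\<close>

lemma gauss_poly_growth_bound:
  assumes "poly_growth f" "s > 0"
  obtains C where "C \<ge> 0" "\<And>q. norm (gauss s q *\<^sub>R f q) \<le> C * gauss (2 * s) q"
proof -
  obtain C N where f: "C \<ge> 0" "\<And>q. cmod (f q) \<le> C * (1 + norm q) ^ N"
    using assms(1) by (rule poly_growthE) blast
  define D where "D = exp ((real N)\<^sup>2 / (4 * (1 / (2 * s))))"
  have "norm (gauss s q *\<^sub>R f q) \<le> (2 * C * D) * gauss (2 * s) q" for q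
  proof -
    have "norm (gauss s q *\<^sub>R f q) \<le> gauss s q * (C * (1 + norm q) ^ N)"
      using gauss_nonneg[OF assms(2), of q] f(2)[of q] by (simp add: mult_left_mono)
    also have "\<dots> \<le> gauss s q * (C * (D * exp (1 / (2 * s) * (norm q)\<^sup>2)))"
      using power_exp_le_exp_square[of "1 / (2 * s)" "norm q" N 0] assms(2) f(1)
        gauss_nonneg[OF assms(2), of q]
      by (intro mult_left_mono) (simp_all add: D_def)
    also have "gauss s q * (C * (D * exp (1 / (2 * s) * (norm q)\<^sup>2))) =
        (C * D / (pi * s)) * (exp (- (norm q)\<^sup>2 / s) * exp (1 / (2 * s) * (norm q)\<^sup>2))"
      by (simp add: gauss_def)
    also have "exp (- (norm q)\<^sup>2 / s) * exp (1 / (2 * s) * (norm q)\<^sup>2) = exp (- (norm q)\<^sup>2 / (2 * s))"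
      using assms(2) by (simp add: exp_add[symmetric] field_simps)
    finally show ?thesis
      using assms(2) by (simp add: gauss_def mult_ac)
  qed
  moreover have "2 * C * D \<ge> 0" using f(1) by (simp add: D_def)
  ultimately show thesis by (rule_tac that)
qed

lemma integrable_gauss_poly_growth:
  assumes "poly_growth f" "s > 0"
  shows "integrable lborel (\<lambda>q. gauss s q *\<^sub>R f q)"
proof -
  obtain C where C: "C \<ge> 0" "\<And>q. norm (gauss s q *\<^sub>R f q) \<le> C * gauss (2 * s) q"
    using gauss_poly_growth_bound[OF assms] by blast
  have [measurable]: "f \<in> borel_measurable borel"
    using assms(1) by (rule poly_growth_measurable)
  show ?thesis
  proof (rule Bochner_Integration.integrable_bound)
    show "integrable lborel (\<lambda>q. C * gauss (2 * s) q)"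
      using integrable_gauss[of "2 * s"] assms by simp
    show "AE q in lborel. norm (gauss s q *\<^sub>R f q) \<le> norm (C * gauss (2 * s) q)"
      using C by (intro AE_I2) (auto intro: order_trans[OF _ abs_ge_self])
  qed simp
qed

section \<open>Gaussian integration by parts (Stein's identity)\<close>

lemma lborel_integral_derivative_eq_0:
  fixes F :: "real \<Rightarrow> complex"
  assumes "\<And>x. (F has_vector_derivative f x) (at x)" "continuous_on UNIV f"
    and "(F \<longlongrightarrow> 0) at_top" "(F \<longlongrightarrow> 0) at_bot"
  shows "integral\<^sup>L lborel f = 0"
proof (cases "integrable lborel f")
  case True
  have "(LBINT x=-\<infinity>..\<infinity>. f x) = 0 - 0"
  proof (rule interval_integral_FTC_integrable)
    show "set_integrable lborel (einterval (-\<infinity>) \<infinity>) f"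
      using True by (simp add: set_integrable_def)
    show "isCont f x" for x
      using assms(2) by (simp add: continuous_on_eq_continuous_at)
  qed (use assms in \<open>auto simp: ereal_tendsto_simps1\<close>)
  then show ?thesis
    by (simp add: interval_lebesgue_integral_le_eq set_lebesgue_integral_def)
\<comment> \<open>Without integrability the Bochner integral is 0 by convention, so the claim
  remains true.\<close>
qed (rule not_integrable_integral_eq)

lemma gauss_has_real_derivative_fst:
  "s > 0 \<Longrightarrow> ((\<lambda>x. gauss s (x, y)) has_real_derivative (- 2 * x / s) * gauss s (x, y)) (at x)"
  unfolding gauss_def norm_Pair real_sqrt_pow2[OF sum_power2_ge_zero]
  by (auto intro!: derivative_eq_intros simp: field_simps)

lemma gauss_has_real_derivative_snd:
  "s > 0 \<Longrightarrow> ((\<lambda>y. gauss s (x, y)) has_real_derivative (- 2 * y / s) * gauss s (x, y)) (at y)"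
  unfolding gauss_def norm_Pair real_sqrt_pow2[OF sum_power2_ge_zero]
  by (auto intro!: derivative_eq_intros simp: field_simps)

lemma tendsto_gauss_poly_growth:
  assumes "poly_growth f" "s > 0" "filterlim (\<lambda>x. norm (q x)) at_top F"
  shows "((\<lambda>x. gauss s (q x) *\<^sub>R f (q x)) \<longlongrightarrow> 0) F"
proof -
  obtain C where C: "C \<ge> 0" "\<And>q. norm (gauss s q *\<^sub>R f q) \<le> C * gauss (2 * s) q"
    using gauss_poly_growth_bound[OF assms(1,2)] by blast
  have "((\<lambda>v. C * (1 / (pi * (2 * s)) * exp (- v\<^sup>2 / (2 * s)))) \<longlongrightarrow> 0) at_top"
    using assms(2) by real_asymp
  from filterlim_compose[OF this assms(3)]
  have "((\<lambda>x. C * gauss (2 * s) (q x)) \<longlongrightarrow> 0) F"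
    by (simp add: gauss_def)
  then show ?thesis
    by (rule Lim_null_comparison[rotated]) (use C in \<open>auto intro!: always_eventually\<close>)
qed

text \<open>The x-derivative of \<open>gauss s * F\<close> is \<open>gauss s\<close> times Fx -
  (2x/s) F. Its integral along each horizontal line is 0, and Fubini gives the identity; s/2 is the
  variance of one coordinate.\<close>

lemma gauss_stein_fst:
  assumes F: "poly_growth F" and Fx: "poly_growth Fx" and s: "s > 0"
    and deriv: "\<And>x y. ((\<lambda>u. F (u, y)) has_vector_derivative Fx (x, y)) (at x)"
  shows "(LINT q|lborel. gauss s q *\<^sub>R (complex_of_real (fst q) * F q)) =
         (s / 2) *\<^sub>R (LINT q|lborel. gauss s q *\<^sub>R Fx q)"
proof -
  let ?G = "\<lambda>q. Fx q - complex_of_real (2 / s) * (complex_of_real (fst q) * F q)"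
  have G: "poly_growth ?G" by (intro poly_growth_intros F Fx)
  have xF: "poly_growth (\<lambda>q. complex_of_real (fst q) * F q)" using F by auto
  have inner: "(\<integral>x. gauss s (x, y) *\<^sub>R ?G (x, y) \<partial>lborel) = 0" for y
  proof (rule lborel_integral_derivative_eq_0)
    show "((\<lambda>x. gauss s (x, y) *\<^sub>R F (x, y)) has_vector_derivative gauss s (x, y) *\<^sub>R ?G (x, y)) (at x)" for x
      by (rule has_vector_derivative_eq_rhs[OF has_vector_derivative_scaleR[OF gauss_has_real_derivative_fst[OF s] deriv]])
        (simp add: scaleR_conv_of_real algebra_simps)
    show "continuous_on UNIV (\<lambda>x. gauss s (x, y) *\<^sub>R ?G (x, y))"
      by (intro continuous_intros poly_growth_continuous_on[OF F] poly_growth_continuous_on[OF Fx])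
    have le: "\<bar>x\<bar> \<le> norm (x, y)" for x
      by (metis norm_fst_le fst_conv real_norm_def)
    have "filterlim (\<lambda>x::real. \<bar>x\<bar>) at_top at_top" "filterlim (\<lambda>x::real. \<bar>x\<bar>) at_top at_bot"
      by real_asymp+
    from this[THEN filterlim_at_top_mono, OF always_eventually, OF allI, OF le]
    have "filterlim (\<lambda>x::real. norm (x, y)) at_top at_top" "filterlim (\<lambda>x::real. norm (x, y)) at_top at_bot" .
    then show "((\<lambda>x. gauss s (x, y) *\<^sub>R F (x, y)) \<longlongrightarrow> 0) at_top" "((\<lambda>x. gauss s (x, y) *\<^sub>R F (x, y)) \<longlongrightarrow> 0) at_bot"
      by (auto intro!: tendsto_gauss_poly_growth F s)
  qed
  have "(LINT q|lborel. gauss s q *\<^sub>R ?G q) = (\<integral>y. (\<integral>x. gauss s (x, y) *\<^sub>R ?G (x, y) \<partial>lborel) \<partial>lborel)"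
    using lborel_pair.integral_snd[of "\<lambda>x y. gauss s (x, y) *\<^sub>R ?G (x, y)"]
      integrable_gauss_poly_growth[OF G s] by (simp add: lborel_prod case_prod_unfold)
  also have "\<dots> = 0"
    unfolding inner by simp
  finally have "0 = (LINT q|lborel. gauss s q *\<^sub>R Fx q - complex_of_real (2 / s) * (gauss s q *\<^sub>R (complex_of_real (fst q) * F q)))"
    by (simp add: scaleR_diff_right)
  also have "\<dots> = (LINT q|lborel. gauss s q *\<^sub>R Fx q) - complex_of_real (2 / s) * (LINT q|lborel. gauss s q *\<^sub>R (complex_of_real (fst q) * F q))"
    using integrable_gauss_poly_growth[OF Fx s] integrable_gauss_poly_growth[OF xF s]
    by (simp del: mult_scaleR_right of_real_divide)
  finally show ?thesis using s by (simp add: scaleR_conv_of_real field_simps)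
qed

lemma gauss_stein_snd:
  assumes F: "poly_growth F" and Fy: "poly_growth Fy" and s: "s > 0"
    and deriv: "\<And>x y. ((\<lambda>u. F (x, u)) has_vector_derivative Fy (x, y)) (at y)"
  shows "(LINT q|lborel. gauss s q *\<^sub>R (complex_of_real (snd q) * F q)) =
         (s / 2) *\<^sub>R (LINT q|lborel. gauss s q *\<^sub>R Fy q)"
proof -
  let ?G = "\<lambda>q. Fy q - complex_of_real (2 / s) * (complex_of_real (snd q) * F q)"
  have G: "poly_growth ?G" by (intro poly_growth_intros F Fy)
  have yF: "poly_growth (\<lambda>q. complex_of_real (snd q) * F q)" using F by auto
  have inner: "(\<integral>y. gauss s (x, y) *\<^sub>R ?G (x, y) \<partial>lborel) = 0" for x
  proof (rule lborel_integral_derivative_eq_0)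
    show "((\<lambda>y. gauss s (x, y) *\<^sub>R F (x, y)) has_vector_derivative gauss s (x, y) *\<^sub>R ?G (x, y)) (at y)" for y
      by (rule has_vector_derivative_eq_rhs[OF has_vector_derivative_scaleR[OF gauss_has_real_derivative_snd[OF s] deriv]])
        (simp add: scaleR_conv_of_real algebra_simps)
    show "continuous_on UNIV (\<lambda>y. gauss s (x, y) *\<^sub>R ?G (x, y))"
      by (intro continuous_intros poly_growth_continuous_on[OF F] poly_growth_continuous_on[OF Fy])
    have le: "\<bar>y\<bar> \<le> norm (x, y)" for y
      by (metis norm_snd_le snd_conv real_norm_def)
    have "filterlim (\<lambda>y::real. \<bar>y\<bar>) at_top at_top" "filterlim (\<lambda>y::real. \<bar>y\<bar>) at_top at_bot"
      by real_asymp+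
    from this[THEN filterlim_at_top_mono, OF always_eventually, OF allI, OF le]
    have "filterlim (\<lambda>y::real. norm (x, y)) at_top at_top" "filterlim (\<lambda>y::real. norm (x, y)) at_top at_bot" .
    then show "((\<lambda>y. gauss s (x, y) *\<^sub>R F (x, y)) \<longlongrightarrow> 0) at_top" "((\<lambda>y. gauss s (x, y) *\<^sub>R F (x, y)) \<longlongrightarrow> 0) at_bot"
      by (auto intro!: tendsto_gauss_poly_growth F s)
  qed
  have "(LINT q|lborel. gauss s q *\<^sub>R ?G q) = (\<integral>x. (\<integral>y. gauss s (x, y) *\<^sub>R ?G (x, y) \<partial>lborel) \<partial>lborel)"
    using lborel_pair.integral_fst[of "\<lambda>x y. gauss s (x, y) *\<^sub>R ?G (x, y)"]
      integrable_gauss_poly_growth[OF G s] by (simp add: lborel_prod case_prod_unfold)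
  also have "\<dots> = 0"
    unfolding inner by simp
  finally have "0 = (LINT q|lborel. gauss s q *\<^sub>R Fy q - complex_of_real (2 / s) * (gauss s q *\<^sub>R (complex_of_real (snd q) * F q)))"
    by (simp add: scaleR_diff_right)
  also have "\<dots> = (LINT q|lborel. gauss s q *\<^sub>R Fy q) - complex_of_real (2 / s) * (LINT q|lborel. gauss s q *\<^sub>R (complex_of_real (snd q) * F q))"
    using integrable_gauss_poly_growth[OF Fy s] integrable_gauss_poly_growth[OF yF s]
    by (simp del: mult_scaleR_right of_real_divide)
  finally show ?thesis using s by (simp add: scaleR_conv_of_real field_simps)
qed

text \<open>\<open>Fz\<close> and \<open>Fw\<close> are the Wirtinger derivatives of \<open>F\<close>.\<close>

lemma gauss_stein_cplx:
  assumes F: "poly_growth F" "poly_growth Fz" "poly_growth Fw" and s: "s > 0"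
    and dx: "\<And>x y. ((\<lambda>u. F (u, y)) has_vector_derivative Fz (x, y) + Fw (x, y)) (at x)"
    and dy: "\<And>x y. ((\<lambda>u. F (x, u)) has_vector_derivative \<i> * (Fz (x, y) - Fw (x, y))) (at y)"
  shows "(LINT q|lborel. gauss s q *\<^sub>R (cplx q * F q)) = s *\<^sub>R (LINT q|lborel. gauss s q *\<^sub>R Fw q)"
proof -
  have 1: "poly_growth (\<lambda>q. complex_of_real (fst q) * F q)" "poly_growth (\<lambda>q. complex_of_real (snd q) * F q)"
    and 2: "poly_growth (\<lambda>q. Fz q + Fw q)" "poly_growth (\<lambda>q. \<i> * (Fz q - Fw q))"
    using F by auto
  note int = integrable_gauss_poly_growth[OF _ s]
  have "(LINT q|lborel. gauss s q *\<^sub>R (cplx q * F q)) =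
     (LINT q|lborel. gauss s q *\<^sub>R (complex_of_real (fst q) * F q) + \<i> * (gauss s q *\<^sub>R (complex_of_real (snd q) * F q)))"
    by (intro Bochner_Integration.integral_cong refl)
      (auto simp: cplx_def complex_eq_iff algebra_simps)
  also have "\<dots> = (LINT q|lborel. gauss s q *\<^sub>R (complex_of_real (fst q) * F q)) +
      \<i> * (LINT q|lborel. gauss s q *\<^sub>R (complex_of_real (snd q) * F q))"
    using int[OF 1(1)] int[OF 1(2)] by (simp del: mult_scaleR_right)
  also have "(LINT q|lborel. gauss s q *\<^sub>R (complex_of_real (fst q) * F q)) =
      (s / 2) *\<^sub>R (LINT q|lborel. gauss s q *\<^sub>R (Fz q + Fw q))"
    by (rule gauss_stein_fst[OF F(1) 2(1) s dx])
  also have "(LINT q|lborel. gauss s q *\<^sub>R (complex_of_real (snd q) * F q)) =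
      (s / 2) *\<^sub>R (LINT q|lborel. gauss s q *\<^sub>R (\<i> * (Fz q - Fw q)))"
    by (rule gauss_stein_snd[OF F(1) 2(2) s dy])
  also have "(LINT q|lborel. gauss s q *\<^sub>R (Fz q + Fw q)) =
     (LINT q|lborel. gauss s q *\<^sub>R Fz q) + (LINT q|lborel. gauss s q *\<^sub>R Fw q)"
    using int[OF F(2)] int[OF F(3)] by (simp add: scaleR_add_right)
  also have "(LINT q|lborel. gauss s q *\<^sub>R (\<i> * (Fz q - Fw q))) =
     \<i> * ((LINT q|lborel. gauss s q *\<^sub>R Fz q) - (LINT q|lborel. gauss s q *\<^sub>R Fw q))"
    using int[OF F(2)] int[OF F(3)]
    by (simp add: scaleR_diff_right mult_scaleR_right[symmetric] del: mult_scaleR_right)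
  finally show ?thesis
    by (simp add: scaleR_conv_of_real algebra_simps)
qed

text \<open>The Hermite recurrence under the integral produces the factor z(p) - z(q). Stein's
  identity evaluates the part with z(q): differentiating the reflected argument p - q gives a minus
  sign, so the net effect is to add s to \<tau>.\<close>

lemma gauss_average_planeherm_Suc:
  fixes s :: real and \<tau> :: complex and p :: "real \<times> real"
  defines "N \<equiv> \<lambda>a b. (LINT q|lborel. gauss s q *\<^sub>R planeherm \<tau> a b (p - q))"
  assumes s: "s > 0"
  shows "N (Suc a) b = cplx p * N a b + (\<tau> + complex_of_real s) * of_nat b * N a (b - 1)"
proof -
  let ?h = "\<lambda>a b q. planeherm \<tau> a b (p - q)"
  have pg [intro]: "poly_growth (?h a b)" for a b
    unfolding cplx_diff by (intro poly_growth_intros)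
  note int = integrable_gauss_poly_growth[OF _ s]
  have der: "((\<lambda>u. ?h a b (u, y)) has_vector_derivative
          (- of_nat a * ?h (a - 1) b (x, y)) + (- of_nat b * ?h a (b - 1) (x, y))) (at x)"
       "((\<lambda>u. ?h a b (x, u)) has_vector_derivative
          \<i> * ((- of_nat a * ?h (a - 1) b (x, y)) - (- of_nat b * ?h a (b - 1) (x, y)))) (at y)" for x y
  proof -
    have "((\<lambda>u. cplx (p - (u, y))) has_vector_derivative -1) (at x)"
         "((\<lambda>u. cnj (cplx (p - (u, y)))) has_vector_derivative -1) (at x)"
      unfolding cplx_diff cplx_Pair by (auto intro!: derivative_eq_intros)
    from has_vector_derivative_cherm[OF this]
    show "((\<lambda>u. ?h a b (u, y)) has_vector_derivative
          (- of_nat a * ?h (a - 1) b (x, y)) + (- of_nat b * ?h a (b - 1) (x, y))) (at x)"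
      by simp
    have "((\<lambda>u. cplx (p - (x, u))) has_vector_derivative - \<i>) (at y)"
         "((\<lambda>u. cnj (cplx (p - (x, u)))) has_vector_derivative \<i>) (at y)"
      unfolding cplx_diff cplx_Pair by (auto intro!: derivative_eq_intros)
    from has_vector_derivative_cherm[OF this]
    show "((\<lambda>u. ?h a b (x, u)) has_vector_derivative
          \<i> * ((- of_nat a * ?h (a - 1) b (x, y)) - (- of_nat b * ?h a (b - 1) (x, y)))) (at y)"
      by (simp add: algebra_simps)
  qed
  have "(LINT q|lborel. gauss s q *\<^sub>R (cplx q * ?h a b q)) =
      s *\<^sub>R (LINT q|lborel. gauss s q *\<^sub>R (- of_nat b * ?h a (b - 1) q))"
    by (rule gauss_stein_cplx[OF _ _ _ s der]) (intro poly_growth_intros pg)+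
  then have stein: "(LINT q|lborel. gauss s q *\<^sub>R (cplx q * ?h a b q)) = - complex_of_real s * of_nat b * N a (b - 1)"
    by (simp add: N_def scaleR_conv_of_real mult.left_commute[of "complex_of_real (gauss _ _)"])
  have zh: "poly_growth (\<lambda>q. cplx q * ?h a b q)" by auto
  have "N (Suc a) b = (LINT q|lborel. cplx p * (gauss s q *\<^sub>R ?h a b q) - gauss s q *\<^sub>R (cplx q * ?h a b q)
      + \<tau> * of_nat b * (gauss s q *\<^sub>R ?h a (b - 1) q))"
    unfolding N_def cherm_Suc_left cplx_diff
    by (intro Bochner_Integration.integral_cong refl) (simp add: algebra_simps scaleR_conv_of_real)
  also have "\<dots> = cplx p * N a b - (LINT q|lborel. gauss s q *\<^sub>R (cplx q * ?h a b q)) + \<tau> * of_nat b * N a (b - 1)"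
    unfolding N_def using int[OF zh] int[OF pg[of a b]] int[OF pg[of a "b - 1"]] by (simp del: mult_scaleR_right)
  finally show ?thesis unfolding stein by (simp add: algebra_simps)
qed

text \<open>Both sides satisfy the same recurrence in a, with parameter \<tau> + s, so only the
  starting value a = 0 has to be found.\<close>

lemma gauss_average_planeherm:
  assumes s: "s > 0"
  shows "(LINT q|lborel. gauss s q *\<^sub>R planeherm \<tau> a b (p - q)) = planeherm (\<tau> + complex_of_real s) a b p"
proof (induction a arbitrary: b)
  case 0
  \<comment> \<open>When the second index is 0 the recurrence loses its \<tau> term, so averaging
    fixes holomorphic powers (a mean value property). Conjugation transfers this to powers of w,
    which is the case a = 0.\<close>
  have left: "(LINT q|lborel. gauss s q *\<^sub>R planeherm \<tau> b 0 (p - q)) = cplx p ^ b" for b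
  proof (induction b)
    case 0
    show ?case
      using integral_gauss[OF s] by (simp add: scaleR_conv_of_real integral_complex_of_real)
  next
    case (Suc b)
    then show ?case using gauss_average_planeherm_Suc[OF s, of \<tau> b 0 p] by simp
  qed
  have "(LINT q|lborel. gauss s q *\<^sub>R planeherm \<tau> 0 b (p - q)) =
      (LINT q|lborel. cnj (gauss s q *\<^sub>R planeherm \<tau> b 0 (p - q)))"
    by (subst cherm_swap[of _ b 0]) (simp add: cherm_swap[of _ b 0])
  also have "\<dots> = cnj (cplx p ^ b)"
    by (simp only: Bochner_Integration.integral_cnj left)
  finally show ?case by simp
next
  case (Suc a)
  then show ?case
    using gauss_average_planeherm_Suc[OF s, of \<tau> a b p] by (simp add: cherm_Suc_left)
qed

section \<open>Eigenfunctions of the semigroup\<close>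

lemma ou_measure_eq: "ou_measure \<rho> = density lborel (\<lambda>q. ennreal (gauss \<rho> q))"
proof -
  have "(\<lambda>(x, y). ennreal (1 / (pi * \<rho>) * exp (- (x\<^sup>2 + y\<^sup>2) / \<rho>))) = (\<lambda>q. ennreal (gauss \<rho> q))"
    by (auto simp: gauss_def norm_Pair fun_eq_iff diff_divide_distrib add_divide_distrib)
  then show ?thesis by (simp add: ou_measure_def)
qed

lemma sets_ou_measure [simp, measurable_cong]: "sets (ou_measure \<rho>) = sets borel"
  by (simp add: ou_measure_def)

lemma space_ou_measure [simp]: "space (ou_measure \<rho>) = UNIV"
  by (simp add: ou_measure_def)

lemma borel_measurable_ou_measure [simp]:
  "borel_measurable (ou_measure \<rho>) = (borel_measurable borel :: (_ \<Rightarrow> 'b::topological_space) set)"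
  by (rule measurable_cong_sets) auto

lemma AE_ou_measure:
  assumes "\<rho> > 0" "Measurable.pred borel P"
  shows "(AE p in ou_measure \<rho>. P p) \<longleftrightarrow> (AE p in lborel. P p)"
  unfolding ou_measure_eq using gauss_pos[OF assms(1)] by (subst AE_density) auto

lemma integrable_ou_measure:
  fixes f :: "real \<times> real \<Rightarrow> 'b::{banach, second_countable_topology}"
  assumes "\<rho> > 0" "f \<in> borel_measurable borel"
  shows "integrable (ou_measure \<rho>) f \<longleftrightarrow> integrable lborel (\<lambda>q. gauss \<rho> q *\<^sub>R f q)"
  unfolding ou_measure_eq using assms gauss_nonneg by (intro integrable_density) auto

lemma integral_ou_measure:
  fixes f :: "real \<times> real \<Rightarrow> 'b::{banach, second_countable_topology}"
  assumes "\<rho> > 0" "f \<in> borel_measurable borel"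
  shows "integral\<^sup>L (ou_measure \<rho>) f = (LINT q|lborel. gauss \<rho> q *\<^sub>R f q)"
  unfolding ou_measure_eq using assms gauss_nonneg by (intro integral_density) auto

text \<open>\<open>cplx\<close> turns the drift matrix into multiplication by -r - i\<Omega>, so the
  matrix exponential series becomes the complex one. The bounded linear inverse \<open>P\<close> of
  \<open>cplx\<close> carries the convergence back to the plane.\<close>

lemma cplx_exp_flow:
  "cplx (exp_flow (drift r \<Omega>) t p) = exp (complex_of_real t * (- complex_of_real r - \<i> * complex_of_real \<Omega>)) * cplx p"
proof -
  define \<theta> where "\<theta> = - complex_of_real r - \<i> * complex_of_real \<Omega>"
  define P where "P = (\<lambda>c. (Re c, Im c))"
  have P: "bounded_linear P"
    unfolding P_def by (intro bounded_linear_Pair bounded_linear_Re bounded_linear_Im)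
  have cP: "cplx (P c) = c" and Pc: "P (cplx q) = q" for c q
    by (simp_all add: P_def cplx_def)
  have drift: "cplx (drift r \<Omega> q) = \<theta> * cplx q" for q
    by (cases q) (simp add: drift_def cplx_def \<theta>_def complex_eq_iff)
  have drift_pow: "cplx ((drift r \<Omega> ^^ k) p) = \<theta> ^ k * cplx p" for k
    by (induction k) (simp_all add: drift)
  have "(\<lambda>k. ((complex_of_real t * \<theta>) ^ k /\<^sub>R fact k) * cplx p) sums (exp (complex_of_real t * \<theta>) * cplx p)"
    by (intro sums_mult2 exp_converges)
  then have "(\<lambda>k. P (((complex_of_real t * \<theta>) ^ k /\<^sub>R fact k) * cplx p)) sums P (exp (complex_of_real t * \<theta>) * cplx p)"
    by (rule bounded_linear.sums[OF P])
  moreover have "P (((complex_of_real t * \<theta>) ^ k /\<^sub>R fact k) * cplx p) = (t ^ k / fact k) *\<^sub>R (drift r \<Omega> ^^ k) p" for k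
  proof -
    have "((complex_of_real t * \<theta>) ^ k /\<^sub>R fact k) * cplx p = (t ^ k / fact k) *\<^sub>R cplx ((drift r \<Omega> ^^ k) p)"
      by (simp add: drift_pow scaleR_conv_of_real power_mult_distrib field_simps)
    also have "\<dots> = cplx ((t ^ k / fact k) *\<^sub>R (drift r \<Omega> ^^ k) p)"
      by (simp add: linear_scale[OF bounded_linear.linear[OF bounded_linear_cplx]])
    finally show ?thesis by (simp add: Pc)
  qed
  ultimately have "exp_flow (drift r \<Omega>) t p = P (exp (complex_of_real t * \<theta>) * cplx p)"
    unfolding exp_flow_def by (simp add: sums_iff)
  then show ?thesis by (simp add: cP \<theta>_def)
qed

lemma norm_exp_flow: "norm (exp_flow (drift r \<Omega>) t p) = exp (- r * t) * norm p"
  using arg_cong[OF cplx_exp_flow[of r \<Omega> t p], of cmod] by (simp add: norm_mult mult.commute)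

text \<open>The variance of the noise accumulated up to time t. For positive r, \<rho> and t it lies
  strictly between 0 and its stationary value \<rho>.\<close>

definition ou_variance :: "real \<Rightarrow> real \<Rightarrow> real \<Rightarrow> real" where
  "ou_variance r \<rho> t = \<rho> * (1 - exp (- 2 * r * t))"

lemma ou_variance_pos: "r > 0 \<Longrightarrow> \<rho> > 0 \<Longrightarrow> t > 0 \<Longrightarrow> 0 < ou_variance r \<rho> t"
  by (simp add: ou_variance_def)

lemma ou_semigroup_eq:
  "ou_semigroup r \<Omega> \<rho> t \<phi> p =
     (LINT q|lborel. gauss (ou_variance r \<rho> t) q *\<^sub>R \<phi> (exp_flow (drift r \<Omega>) t p - q))"
  unfolding ou_semigroup_def gauss_def ou_variance_def scaleR_scaleR[symmetric]
    integral_scaleR_right by (simp add: mult.assoc)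

lemma poly_growth_J: "poly_growth (J \<rho> m n)"
  unfolding J_eq_planeherm by (intro poly_growth_intros)

definition ou_eigenvalue :: "real \<Rightarrow> real \<Rightarrow> nat \<Rightarrow> nat \<Rightarrow> complex" where
  "ou_eigenvalue r \<Omega> m n =
     - complex_of_real r * (of_nat m + of_nat n) - \<i> * (of_nat m - of_nat n) * complex_of_real \<Omega>"

text \<open>With u = exp(-t(r + i\<Omega>)), averaging moves \<tau> from -\<rho> to -\<rho> |u|^2.
  This is the weight attached to replacing z by u z and w by its conjugate, so homogeneity extracts
  u^m (cnj u)^n.\<close>

lemma ou_semigroup_J:
  assumes "r > 0" "\<rho> > 0" "t > 0"
  shows "ou_semigroup r \<Omega> \<rho> t (J \<rho> m n) p = exp (complex_of_real t * ou_eigenvalue r \<Omega> m n) * J \<rho> m n p"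
proof -
  define u where "u = exp (complex_of_real t * (- complex_of_real r - \<i> * complex_of_real \<Omega>))"
  have cu: "cnj u = exp (complex_of_real t * (- complex_of_real r + \<i> * complex_of_real \<Omega>))"
    by (simp add: u_def exp_cnj)
  have uu: "u * cnj u = complex_of_real (exp (- 2 * r * t))"
    unfolding cu unfolding u_def by (simp flip: exp_add exp_of_real add: algebra_simps)
  have "ou_semigroup r \<Omega> \<rho> t (J \<rho> m n) p =
     planeherm (- complex_of_real \<rho> + complex_of_real (ou_variance r \<rho> t)) m n (exp_flow (drift r \<Omega>) t p)"
    unfolding ou_semigroup_eq J_eq_planeherm by (rule gauss_average_planeherm[OF ou_variance_pos[OF assms]])
  also have "\<dots> = cherm (complex_of_real (exp (- 2 * r * t)) * (- complex_of_real \<rho>)) m n (u * cplx p) (cnj u * cnj (cplx p))"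
    unfolding cplx_exp_flow u_def[symmetric] by (simp add: ou_variance_def algebra_simps)
  also have "\<dots> = u ^ m * cnj u ^ n * J \<rho> m n p"
    unfolding cherm_scale[OF uu] J_eq_planeherm ..
  also have "u ^ m * cnj u ^ n = exp (complex_of_real t * ou_eigenvalue r \<Omega> m n)"
    unfolding cu unfolding u_def exp_of_nat_mult[symmetric] exp_add[symmetric] ou_eigenvalue_def
    by (simp add: algebra_simps)
  finally show ?thesis .
qed

text \<open>If it vanished identically, so would its partial derivatives, down to \<open>planeherm \<tau> 0 0 = 1\<close>.\<close>

lemma planeherm_not_identically_0: "\<exists>p. planeherm \<tau> a b p \<noteq> 0"
proof (induction "a + b" arbitrary: a b)
  case (Suc k)
  show ?case
  proof (rule ccontr)
    assume "\<not> ?thesis"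
    then have zero: "planeherm \<tau> a b = (\<lambda>p. 0)" by auto
    have z: "of_nat a * planeherm \<tau> (a - 1) b p = 0 \<and> of_nat b * planeherm \<tau> a (b - 1) p = 0" for p
    proof (cases p)
      case (Pair x y)
      have "((\<lambda>s. 0 :: complex) has_vector_derivative of_nat a * planeherm \<tau> (a - 1) b (x, y) + of_nat b * planeherm \<tau> a (b - 1) (x, y)) (at x)"
        using has_vector_derivative_planeherm_fst[of \<tau> a b y x] fun_cong[OF zero] by simp
      then have 1: "of_nat a * planeherm \<tau> (a - 1) b (x, y) + of_nat b * planeherm \<tau> a (b - 1) (x, y) = 0"
        by (rule vector_derivative_unique_at) simp
      have "((\<lambda>s. 0 :: complex) has_vector_derivative \<i> * (of_nat a * planeherm \<tau> (a - 1) b (x, y) - of_nat b * planeherm \<tau> a (b - 1) (x, y))) (at y)"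
        using has_vector_derivative_planeherm_snd[of \<tau> a b x y] fun_cong[OF zero] by simp
      then have 2: "\<i> * (of_nat a * planeherm \<tau> (a - 1) b (x, y) - of_nat b * planeherm \<tau> a (b - 1) (x, y)) = 0"
        by (rule vector_derivative_unique_at) simp
      from 1 2 show ?thesis unfolding Pair by (simp add: add_eq_0_iff)
    qed
    show False
    proof (cases a)
      case 0
      then show ?thesis using Suc.hyps(1)[of 0 "b - 1"] Suc.hyps(2) z by auto
    next
      case (Suc a')
      then show ?thesis using Suc.hyps(1)[of a' b] Suc.hyps(2) z by (auto simp del: of_nat_Suc)
    qed
  qed
qed simp

text \<open>The zero set of a continuous function is closed, and a closed set of full Lebesgue
  measure is the whole plane.\<close>

lemma not_AE_J_eq_0:
  assumes "\<rho> > 0"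
  shows "\<not> (AE p in ou_measure \<rho>. J \<rho> m n p = 0)"
proof
  assume *: "AE p in ou_measure \<rho>. J \<rho> m n p = 0"
  have [measurable]: "J \<rho> m n \<in> borel_measurable borel"
    by (rule poly_growth_measurable[OF poly_growth_J])
  have "AE p in lborel. J \<rho> m n p = 0"
    using * assms by (subst (asm) AE_ou_measure) auto
  then have "AE p in lebesgue. p \<in> {p. J \<rho> m n p = 0}"
    by (auto intro: AE_completion)
  moreover have "closed {p. J \<rho> m n p = 0}"
    using poly_growth_J[of \<rho> m n] unfolding poly_growth_def by (intro closed_Collect_eq continuous_on_const) auto
  ultimately have "J \<rho> m n p = 0" for p
    using mem_closed_if_AE_lebesgue by blast
  then show False
    using planeherm_not_identically_0 unfolding J_eq_planeherm by blast
qed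

lemma poly_growth_in_L2:
  assumes "poly_growth f" "\<rho> > 0"
  shows "f \<in> L2_mu \<rho>"
proof -
  have [measurable]: "f \<in> borel_measurable borel" using assms(1) by (rule poly_growth_measurable)
  have "integrable lborel (\<lambda>q. norm (gauss \<rho> q *\<^sub>R (f q * f q)))"
    by (intro integrable_norm integrable_gauss_poly_growth poly_growth_mult assms)
  then have "integrable lborel (\<lambda>q. gauss \<rho> q *\<^sub>R (cmod (f q))\<^sup>2)"
    using gauss_nonneg[OF assms(2)] by (simp add: norm_mult power2_eq_square)
  then show ?thesis
    using assms by (simp add: L2_mu_def integrable_ou_measure)
qed

lemma L2_mu_nn_integral_finite:
  assumes "f \<in> L2_mu \<rho>"
  shows "(\<integral>\<^sup>+ p. ennreal ((cmod (f p))\<^sup>2) \<partial>ou_measure \<rho>) < \<infinity>"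
  using assms unfolding L2_mu_def by (auto simp: integrable_iff_bounded)

lemma L2_mu_cmult:
  assumes "f \<in> L2_mu \<rho>"
  shows "(\<lambda>p. c * f p) \<in> L2_mu \<rho>"
  using assms unfolding L2_mu_def by (auto simp: norm_mult power_mult_distrib)

lemma exp_difference_quotient_tendsto:
  "((\<lambda>t. (exp (complex_of_real t * c) - 1) /\<^sub>R t) \<longlongrightarrow> c) (at_right 0)"
proof -
  have "((\<lambda>z. exp (z * c)) has_field_derivative c) (at 0)"
    by (auto intro!: derivative_eq_intros)
  then have "((\<lambda>z. (exp (z * c) - 1) / z) \<longlongrightarrow> c) (at 0)"
    by (simp add: DERIV_def)
  moreover have "filterlim complex_of_real (at 0) (at_right 0)"
    by (intro filterlim_atI tendsto_eq_intros)
      (auto simp: eventually_at_right_less eventually_mono[OF eventually_at_right_less])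
  ultimately have "((\<lambda>t. (exp (complex_of_real t * c) - 1) / complex_of_real t) \<longlongrightarrow> c) (at_right 0)"
    by (rule filterlim_compose)
  then show ?thesis
    by (simp add: scaleR_conv_of_real divide_inverse mult.commute)
qed

text \<open>As \<open>J\<close> is an exact eigenfunction of every \<open>P\<^sub>t\<close>, the
  generator defect is a scalar times \<open>J\<close>: its squared norm factors into a number
  tending to 0 and the finite squared norm of \<open>J\<close>.\<close>

lemma ou_generator_J:
  assumes "r > 0" "\<rho> > 0"
  shows "ou_generator r \<Omega> \<rho> (J \<rho> m n) (\<lambda>p. ou_eigenvalue r \<Omega> m n * J \<rho> m n p)"
proof -
  define ev where "ev = ou_eigenvalue r \<Omega> m n"
  let ?J = "J \<rho> m n"
  have L2: "?J \<in> L2_mu \<rho>" using poly_growth_J assms(2) by (rule poly_growth_in_L2)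
  then have [measurable]: "?J \<in> borel_measurable borel" by (simp add: L2_mu_def)
  define I where "I = (\<integral>\<^sup>+ p. ennreal ((cmod (?J p))\<^sup>2) \<partial>ou_measure \<rho>)"
  have I: "I < \<infinity>" unfolding I_def using L2 by (rule L2_mu_nn_integral_finite)
  let ?\<kappa> = "\<lambda>t. (exp (complex_of_real t * ev) - 1) /\<^sub>R t - ev"
  have "((\<lambda>t. ?\<kappa> t) \<longlongrightarrow> ev - ev) (at_right 0)"
    by (intro tendsto_intros exp_difference_quotient_tendsto)
  then have "((\<lambda>t. (cmod (?\<kappa> t))\<^sup>2) \<longlongrightarrow> (cmod 0)\<^sup>2) (at_right 0)"
    by (intro tendsto_intros) simp
  then have "((\<lambda>t. I * ennreal ((cmod (?\<kappa> t))\<^sup>2)) \<longlongrightarrow> I * ennreal ((cmod 0)\<^sup>2)) (at_right 0)"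
    using I by (intro ennreal_tendsto_cmult tendsto_ennrealI) auto
  then have "((\<lambda>t. ennreal ((cmod (?\<kappa> t))\<^sup>2) * I) \<longlongrightarrow> 0) (at_right 0)"
    by (simp add: mult.commute)
  moreover have "\<forall>\<^sub>F t in at_right 0. ennreal ((cmod (?\<kappa> t))\<^sup>2) * I =
      (\<integral>\<^sup>+ p. ennreal ((cmod ((ou_semigroup r \<Omega> \<rho> t ?J p - ?J p) /\<^sub>R t - ev * ?J p))\<^sup>2) \<partial>ou_measure \<rho>)"
    using eventually_at_right_less[of 0]
  proof eventually_elim
    case (elim t)
    have "(ou_semigroup r \<Omega> \<rho> t ?J p - ?J p) /\<^sub>R t - ev * ?J p = ?\<kappa> t * ?J p" for p
      unfolding ou_semigroup_J[OF assms elim] ev_def[symmetric] by (simp add: scaleR_conv_of_real algebra_simps)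
    then show ?case
      by (simp add: I_def norm_mult power_mult_distrib ennreal_mult nn_integral_cmult)
  qed
  ultimately show ?thesis
    unfolding ou_generator_def ev_def[symmetric]
    using L2 L2_mu_cmult[OF L2] by (auto cong: tendsto_cong)
qed

section \<open>The adjoint semigroup\<close>

lemma lborel_distr_reflect: "distr lborel borel (\<lambda>q. w - q) = (lborel :: 'a::euclidean_space measure)"
  using lborel_affine[of "- 1" w] by (simp add: density_1)

lemma lborel_integral_reflect:
  fixes f :: "'a::euclidean_space \<Rightarrow> 'b::{banach, second_countable_topology}"
  assumes "f \<in> borel_measurable borel"
  shows "(LINT q|lborel. f (w - q)) = integral\<^sup>L lborel f"
  using integral_distr[of "\<lambda>q. w - q" lborel borel f] assms by (simp add: lborel_distr_reflect)

lemma lborel_integrable_reflect: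
  fixes f :: "'a::euclidean_space \<Rightarrow> 'b::{banach, second_countable_topology}"
  assumes "integrable lborel f"
  shows "integrable lborel (\<lambda>q. f (w - q))"
  using integrable_distr[of "\<lambda>q. w - q" lborel borel f] assms by (simp add: lborel_distr_reflect)

lemma continuous_on_exp_flow: "continuous_on S (exp_flow (drift r \<Omega>) t)"
proof -
  define u where "u = exp (complex_of_real t * (- complex_of_real r - \<i> * complex_of_real \<Omega>))"
  have "exp_flow (drift r \<Omega>) t = (\<lambda>p. (Re (u * cplx p), Im (u * cplx p)))"
    unfolding u_def cplx_exp_flow[symmetric] by (simp add: cplx_def fun_eq_iff)
  then show ?thesis by (simp only:) (intro continuous_intros)
qed

lemma borel_measurable_exp_flow [measurable]: "exp_flow (drift r \<Omega>) t \<in> borel_measurable borel"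
  by (intro borel_measurable_continuous_onI continuous_on_exp_flow)

text \<open>Substituting w - q for q, where w is the image of p under the flow, moves p out of
  \<open>f\<close> and into a kernel. This form gives measurability in p and allows Fubini.\<close>

lemma ou_semigroup_kernel:
  assumes "f \<in> borel_measurable borel"
  shows "ou_semigroup r \<Omega> \<rho> t f p =
    (LINT q|lborel. gauss (ou_variance r \<rho> t) (exp_flow (drift r \<Omega>) t p - q) *\<^sub>R f q)"
  unfolding ou_semigroup_eq
  using lborel_integral_reflect[of "\<lambda>q. gauss (ou_variance r \<rho> t) (exp_flow (drift r \<Omega>) t p - q) *\<^sub>R f q" "exp_flow (drift r \<Omega>) t p"]
    assms by simp

lemma borel_measurable_ou_semigroup [measurable]:
  assumes [measurable]: "f \<in> borel_measurable borel"
  shows "ou_semigroup r \<Omega> \<rho> t f \<in> borel_measurable borel"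
  unfolding ou_semigroup_kernel[OF assms, abs_def] by measurable

text \<open>Reversibility up to reversal of the rotation. With c = exp(-2rt) and s = \<rho>(1 - c),
  the quadratic terms agree because 1/\<rho> + c/s = 1/s; the cross terms agree because the two
  flows multiply by conjugate numbers.\<close>

lemma gauss_detailed_balance:
  assumes "r > 0" "\<rho> > 0" "t > 0"
  shows "gauss \<rho> p * gauss (ou_variance r \<rho> t) (exp_flow (drift r \<Omega>) t p - q) =
         gauss \<rho> q * gauss (ou_variance r \<rho> t) (exp_flow (drift r (- \<Omega>)) t q - p)"
proof -
  define u where "u = exp (complex_of_real t * (- complex_of_real r - \<i> * complex_of_real \<Omega>))"
  have u': "cnj u = exp (complex_of_real t * (- complex_of_real r - \<i> * complex_of_real (- \<Omega>)))"
    by (simp add: u_def exp_cnj)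
  define s where "s = ou_variance r \<rho> t"
  have s: "s > 0" unfolding s_def using assms by (rule ou_variance_pos)
  define c where "c = (cmod u)\<^sup>2"
  have "c = exp (- 2 * r * t)"
    by (simp add: c_def u_def power2_eq_square flip: exp_add)
  then have s_c: "s = \<rho> * (1 - c)" by (simp add: s_def ou_variance_def)
  then have c1: "c \<noteq> 1" using s by auto
  have sq: "(cmod (a - b))\<^sup>2 = (cmod a)\<^sup>2 + (cmod b)\<^sup>2 - 2 * Re (a * cnj b)" for a b
    by (simp only: cmod_power2) (simp add: power2_eq_square algebra_simps)
  have 1: "(norm (exp_flow (drift r \<Omega>) t p - q))\<^sup>2 = c * (norm p)\<^sup>2 + (norm q)\<^sup>2 - 2 * Re (u * cplx p * cnj (cplx q))"
    unfolding norm_cplx[symmetric] cplx_diff cplx_exp_flow u_def[symmetric] sq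
    by (simp add: c_def norm_mult power_mult_distrib)
  have 2: "(norm (exp_flow (drift r (- \<Omega>)) t q - p))\<^sup>2 = c * (norm q)\<^sup>2 + (norm p)\<^sup>2 - 2 * Re (cnj u * cplx q * cnj (cplx p))"
    unfolding norm_cplx[symmetric] cplx_diff cplx_exp_flow u'[symmetric] sq
    by (simp add: c_def norm_mult power_mult_distrib)
  have 3: "Re (cnj u * cplx q * cnj (cplx p)) = Re (u * cplx p * cnj (cplx q))"
    by (simp add: algebra_simps)
  have "- (norm p)\<^sup>2 / \<rho> + - (norm (exp_flow (drift r \<Omega>) t p - q))\<^sup>2 / s =
        - (norm q)\<^sup>2 / \<rho> + - (norm (exp_flow (drift r (- \<Omega>)) t q - p))\<^sup>2 / s"
    unfolding 1 2 3 using s assms(2) c1 unfolding s_c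
    by (simp add: divide_simps) (simp add: algebra_simps)
  then show ?thesis
    unfolding s_def[symmetric] gauss_def by (simp add: mult.assoc mult.left_commute flip: exp_add)
qed

lemma L2_mu_measurable [measurable_dest]: "f \<in> L2_mu \<rho> \<Longrightarrow> f \<in> borel_measurable borel"
  by (simp add: L2_mu_def)

lemma L2_mu_mult_integrable:
  assumes f: "f \<in> L2_mu \<rho>" and g: "g \<in> L2_mu \<rho>"
  shows "integrable (ou_measure \<rho>) (\<lambda>p. f p * g p)"
proof (rule Bochner_Integration.integrable_bound)
  show "integrable (ou_measure \<rho>) (\<lambda>p. (cmod (f p))\<^sup>2 + (cmod (g p))\<^sup>2)"
    using f g by (simp add: L2_mu_def)
  show "(\<lambda>p. f p * g p) \<in> borel_measurable (ou_measure \<rho>)"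
    using L2_mu_measurable[OF f] L2_mu_measurable[OF g] by simp
  have "a * b \<le> a\<^sup>2 + b\<^sup>2" if "a \<ge> 0" "b \<ge> 0" for a b :: real
    using sum_squares_bound[of a b] that mult_nonneg_nonneg[OF that] by linarith
  then show "AE p in ou_measure \<rho>. cmod (f p * g p) \<le> norm ((cmod (f p))\<^sup>2 + (cmod (g p))\<^sup>2)"
    by (simp add: norm_mult)
qed

lemma L2_mu_integrable_gauss_mult:
  assumes f: "f \<in> L2_mu \<rho>" and g: "poly_growth g" and \<rho>: "\<rho> > 0"
  shows "integrable lborel (\<lambda>q. gauss \<rho> q *\<^sub>R (f q * g q))"
  using L2_mu_mult_integrable[OF f poly_growth_in_L2[OF g \<rho>]] integrable_ou_measure[OF \<rho>, of "\<lambda>q. f q * g q"]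
    L2_mu_measurable[OF f] poly_growth_measurable[OF g] by simp

text \<open>The growth rate of \<psi> survives averaging, since 1 + |w - q| is at most (1 + |w|)(1 +
  |q|) and the factor in q has finite Gaussian moments. It supplies the majorant for Fubini
  below.\<close>

lemma gauss_average_norm_bound:
  assumes "poly_growth \<psi>" "s > 0"
  obtains C N where "\<And>w. (LINT q|lborel. gauss s (w - q) * cmod (\<psi> q)) \<le> C * (1 + norm w) ^ N" "C \<ge> 0"
proof -
  obtain C N where C: "C \<ge> 0" "\<And>q. cmod (\<psi> q) \<le> C * (1 + norm q) ^ N"
    using assms(1) by (rule poly_growthE) blast
  have int: "integrable lborel (\<lambda>q. gauss s q * (1 + norm q) ^ N)"
  proof -
    have "norm (gauss s q *\<^sub>R complex_of_real ((1 + norm q) ^ N)) = gauss s q * (1 + norm q) ^ N" for q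
      using gauss_nonneg[OF assms(2), of q] by (simp add: norm_power del: of_real_add)
    then show ?thesis
      using integrable_norm[OF integrable_gauss_poly_growth[OF poly_growth_norm_power[of N] assms(2)]]
      by (simp only:)
  qed
  define M where "M = (LINT q|lborel. gauss s q * (1 + norm q) ^ N)"
  have M: "M \<ge> 0" unfolding M_def using gauss_nonneg[OF assms(2)] by simp
  have [measurable]: "\<psi> \<in> borel_measurable borel" using assms(1) by (rule poly_growth_measurable)
  have "(LINT q|lborel. gauss s (w - q) * cmod (\<psi> q)) \<le> (C * M) * (1 + norm w) ^ N" for w
  proof -
    have "(LINT q|lborel. gauss s (w - q) * cmod (\<psi> q)) = (LINT q|lborel. gauss s q * cmod (\<psi> (w - q)))"
      using lborel_integral_reflect[of "\<lambda>q. gauss s (w - q) * cmod (\<psi> q)" w] by simp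
    also have "\<dots> \<le> (LINT q|lborel. (C * (1 + norm w) ^ N) * (gauss s q * (1 + norm q) ^ N))"
    proof (rule integral_mono_AE')
      show "integrable lborel (\<lambda>q. (C * (1 + norm w) ^ N) * (gauss s q * (1 + norm q) ^ N))"
        using int by simp
      have "gauss s q * cmod (\<psi> (w - q)) \<le> (C * (1 + norm w) ^ N) * (gauss s q * (1 + norm q) ^ N)" for q
      proof -
        have "cmod (\<psi> (w - q)) \<le> C * ((1 + norm w) ^ N * (1 + norm q) ^ N)"
          using order_trans[OF C(2) mult_left_mono[OF one_plus_norm_diff_power_le C(1)]] .
        from mult_left_mono[OF this gauss_nonneg[OF assms(2), of q]] show ?thesis by (simp add: mult_ac)
      qed
      then show "AE q in lborel. gauss s q * cmod (\<psi> (w - q)) \<le> (C * (1 + norm w) ^ N) * (gauss s q * (1 + norm q) ^ N)"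
        by simp
      show "AE q in lborel. 0 \<le> (C * (1 + norm w) ^ N) * (gauss s q * (1 + norm q) ^ N)"
        using gauss_nonneg[OF assms(2)] C(1) by simp
    qed
    also have "\<dots> = (C * M) * (1 + norm w) ^ N" by (simp add: M_def)
    finally show ?thesis .
  qed
  then show thesis
    by (rule that) (use C M in simp)
qed

text \<open>Detailed balance lets one kernel \<open>K\<close> be read from either side; Fubini
  exchanges the two readings. Absolute integrability is checked by integrating \<psi> first: its
  average has polynomial growth, which can be paired with the merely square integrable
  \<open>f\<close>.\<close>

lemma ou_semigroup_adjoint:
  assumes f: "f \<in> L2_mu \<rho>" and \<psi>: "poly_growth \<psi>" and pos: "r > 0" "\<rho> > 0" "t > 0"
  shows "integrable (ou_measure \<rho>) (\<lambda>p. ou_semigroup r \<Omega> \<rho> t f p * \<psi> p)" (is ?int)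
    and "(LINT p|ou_measure \<rho>. ou_semigroup r \<Omega> \<rho> t f p * \<psi> p) =
         (LINT p|ou_measure \<rho>. f p * ou_semigroup r (- \<Omega>) \<rho> t \<psi> p)" (is ?eq)
proof -
  define s where "s = ou_variance r \<rho> t"
  have s: "s > 0" unfolding s_def using pos by (rule ou_variance_pos)
  define E where "E = exp_flow (drift r \<Omega>) t"
  define E' where "E' = exp_flow (drift r (- \<Omega>)) t"
  have [measurable]: "f \<in> borel_measurable borel" "\<psi> \<in> borel_measurable borel"
    "E \<in> borel_measurable borel" "E' \<in> borel_measurable borel"
    using L2_mu_measurable[OF f] poly_growth_measurable[OF \<psi>] by (auto simp: E_def E'_def)
  have Pf: "ou_semigroup r \<Omega> \<rho> t f p = (LINT q|lborel. gauss s (E p - q) *\<^sub>R f q)" for p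
    by (simp add: ou_semigroup_kernel s_def E_def)
  have P\<psi>: "ou_semigroup r (- \<Omega>) \<rho> t \<psi> q = (LINT p|lborel. gauss s (E' q - p) *\<^sub>R \<psi> p)" for q
    by (simp add: ou_semigroup_kernel s_def E'_def)
  have balance: "gauss \<rho> p * gauss s (E p - q) = gauss \<rho> q * gauss s (E' q - p)" for p q
    unfolding s_def E_def E'_def by (rule gauss_detailed_balance[OF pos])
  define K where "K = (\<lambda>(q, p). (gauss \<rho> q * gauss s (E' q - p)) *\<^sub>R (f q * \<psi> p))"
  have [measurable]: "K \<in> borel_measurable (lborel \<Otimes>\<^sub>M lborel)"
    unfolding K_def by measurable
  have int_\<psi>: "integrable lborel (\<lambda>p. gauss s (w - p) *\<^sub>R \<psi> p)" for w
    using lborel_integrable_reflect[OF integrable_gauss_poly_growth[OF poly_growth_reflect[OF \<psi>] s], of w w] by simp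
  have K_inner: "(LINT p|lborel. norm (K (q, p))) = gauss \<rho> q * cmod (f q) * (LINT p|lborel. gauss s (E' q - p) * cmod (\<psi> p))" for q
    using gauss_nonneg[OF s] gauss_nonneg[OF pos(2)] unfolding K_def prod.case
    by (subst integral_mult_right_zero[symmetric]) (simp add: norm_mult abs_mult mult_ac)
  obtain C N where C: "\<And>w. (LINT q|lborel. gauss s (w - q) * cmod (\<psi> q)) \<le> C * (1 + norm w) ^ N" "C \<ge> 0"
    using gauss_average_norm_bound[OF \<psi> s] by blast
  have "integrable (lborel \<Otimes>\<^sub>M lborel) K"
  proof (rule lborel_pair.Fubini_integrable)
    show "integrable lborel (\<lambda>q. LINT p|lborel. norm (K (q, p)))"
    proof (rule Bochner_Integration.integrable_bound)
      show "integrable lborel (\<lambda>q. C * norm (gauss \<rho> q *\<^sub>R (f q * complex_of_real ((1 + norm q) ^ N))))"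
        using L2_mu_integrable_gauss_mult[OF f poly_growth_norm_power pos(2)] by (intro integrable_mult_right integrable_norm)
      have "norm (LINT p|lborel. norm (K (q, p))) \<le> norm (C * norm (gauss \<rho> q *\<^sub>R (f q * complex_of_real ((1 + norm q) ^ N))))" for q
      proof -
        \<comment> \<open>The flow is a contraction, so the polynomial bound at \<open>E' q\<close>
          can be replaced by the same bound at q.\<close>
        have "norm (E' q) \<le> norm q"
          using pos unfolding E'_def norm_exp_flow by (simp add: mult_left_le_one_le)
        then have "C * (1 + norm (E' q)) ^ N \<le> C * (1 + norm q) ^ N"
          using C(2) by (intro mult_left_mono power_mono) auto
        with C(1)[of "E' q"] have "(LINT p|lborel. gauss s (E' q - p) * cmod (\<psi> p)) \<le> C * (1 + norm q) ^ N"
          by linarith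
        then have "gauss \<rho> q * cmod (f q) * (LINT p|lborel. gauss s (E' q - p) * cmod (\<psi> p)) \<le> gauss \<rho> q * cmod (f q) * (C * (1 + norm q) ^ N)"
          using gauss_nonneg[OF pos(2)] by (intro mult_left_mono) auto
        moreover have "0 \<le> (LINT p|lborel. gauss s (E' q - p) * cmod (\<psi> p))"
          using gauss_nonneg[OF s] by simp
        ultimately show ?thesis
          unfolding K_inner using gauss_nonneg[OF pos(2), of q] C(2)
          by (simp add: norm_mult norm_power abs_mult mult_ac del: of_real_add)
      qed
      then show "AE q in lborel. norm (LINT p|lborel. norm (K (q, p))) \<le> norm (C * norm (gauss \<rho> q *\<^sub>R (f q * complex_of_real ((1 + norm q) ^ N))))"
        by simp
    qed measurable
    have "K (q, p) = (gauss \<rho> q *\<^sub>R f q) * (gauss s (E' q - p) *\<^sub>R \<psi> p)" for q p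
      by (simp add: K_def)
    then show "AE q in lborel. integrable lborel (\<lambda>p. K (q, p))"
      using int_\<psi> by (auto intro!: AE_I2 integrable_mult_right simp del: mult_scaleR_left mult_scaleR_right)
  qed measurable
  then have K: "integrable (lborel \<Otimes>\<^sub>M lborel) (case_prod (\<lambda>q p. K (q, p)))" by simp
  have inner1: "(LINT q|lborel. K (q, p)) = gauss \<rho> p *\<^sub>R (ou_semigroup r \<Omega> \<rho> t f p * \<psi> p)" for p
  proof -
    have "K (q, p) = (gauss \<rho> p *\<^sub>R \<psi> p) * (gauss s (E p - q) *\<^sub>R f q)" for q
      by (simp add: K_def balance[symmetric] mult_ac)
    then show ?thesis by (simp add: Pf mult.commute del: mult_scaleR_right)
  qed
  have inner2: "(LINT p|lborel. K (q, p)) = gauss \<rho> q *\<^sub>R (f q * ou_semigroup r (- \<Omega>) \<rho> t \<psi> q)" for q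
  proof -
    have "K (q, p) = (gauss \<rho> q *\<^sub>R f q) * (gauss s (E' q - p) *\<^sub>R \<psi> p)" for p
      by (simp add: K_def)
    then show ?thesis by (simp add: P\<psi> del: mult_scaleR_right)
  qed
  show ?int
    using lborel_pair.integrable_snd[OF K] pos by (subst integrable_ou_measure) (auto simp: inner1)
  show ?eq
    using lborel_pair.Fubini_integral[OF K] pos by (simp add: integral_ou_measure inner1 inner2)
qed

section \<open>Functions orthogonal to all polynomials\<close>

text \<open>Passing to the adjoint, the pairing of the difference quotient of \<open>f\<close> with
  \<psi> is (exp(t\<kappa>) - 1)/t times the pairing of \<open>f\<close> with \<psi>, which tends to
  \<kappa> times that pairing. By Cauchy-Schwarz, convergence in \<open>L\<^sup>2(\<mu>)\<close>
  forces the same limit to be the pairing of \<open>g\<close> with \<psi>.\<close>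

lemma ou_generator_pairing:
  assumes gen: "ou_generator r \<Omega> \<rho> f g" and \<psi>: "poly_growth \<psi>" and pos: "r > 0" "\<rho> > 0"
    and \<kappa>: "\<And>t p. t > 0 \<Longrightarrow> ou_semigroup r (- \<Omega>) \<rho> t \<psi> p = exp (complex_of_real t * \<kappa>) * \<psi> p"
  shows "(LINT p|ou_measure \<rho>. g p * \<psi> p) = \<kappa> * (LINT p|ou_measure \<rho>. f p * \<psi> p)"
proof -
  have f: "f \<in> L2_mu \<rho>" and g: "g \<in> L2_mu \<rho>" using gen by (auto simp: ou_generator_def)
  have \<psi>2: "\<psi> \<in> L2_mu \<rho>" using \<psi> pos(2) by (rule poly_growth_in_L2)
  note [measurable] = L2_mu_measurable[OF f] L2_mu_measurable[OF g] L2_mu_measurable[OF \<psi>2]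
  define D where "D t p = (ou_semigroup r \<Omega> \<rho> t f p - f p) /\<^sub>R t - g p" for t p
  have [measurable]: "D t \<in> borel_measurable borel" for t unfolding D_def by measurable
  define A where "A t = (\<integral>\<^sup>+ p. ennreal ((cmod (D t p))\<^sup>2) \<partial>ou_measure \<rho>)" for t
  have A0: "(A \<longlongrightarrow> 0) (at_right 0)"
    using gen unfolding ou_generator_def A_def D_def by simp
  define I where "I = (\<integral>\<^sup>+ p. ennreal ((cmod (\<psi> p))\<^sup>2) \<partial>ou_measure \<rho>)"
  have I: "I < \<infinity>" unfolding I_def using \<psi>2 by (rule L2_mu_nn_integral_finite)
  let ?F = "LINT p|ou_measure \<rho>. f p * \<psi> p" and ?G = "LINT p|ou_measure \<rho>. g p * \<psi> p"
  let ?L = "\<lambda>t. (exp (complex_of_real t * \<kappa>) - 1) /\<^sub>R t * ?F - ?G"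
  have bound: "ennreal ((cmod (?L t))\<^sup>2) \<le> I * A t" if t: "t > 0" for t
  proof -
    note int = L2_mu_mult_integrable[OF f \<psi>2] L2_mu_mult_integrable[OF g \<psi>2]
      ou_semigroup_adjoint(1)[OF f \<psi> pos t, of \<Omega>]
    have D: "D t p * \<psi> p = (ou_semigroup r \<Omega> \<rho> t f p * \<psi> p - f p * \<psi> p) /\<^sub>R t - g p * \<psi> p" for p
      by (simp add: D_def algebra_simps)
    have int_D: "integrable (ou_measure \<rho>) (\<lambda>p. D t p * \<psi> p)"
      unfolding D using int by (intro Bochner_Integration.integrable_diff integrable_scaleR_right) auto
    have "(LINT p|ou_measure \<rho>. D t p * \<psi> p) = ((LINT p|ou_measure \<rho>. f p * ou_semigroup r (- \<Omega>) \<rho> t \<psi> p) - ?F) /\<^sub>R t - ?G"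
      unfolding D using int by (simp add: ou_semigroup_adjoint(2)[OF f \<psi> pos t])
    also have "(LINT p|ou_measure \<rho>. f p * ou_semigroup r (- \<Omega>) \<rho> t \<psi> p) = exp (complex_of_real t * \<kappa>) * ?F"
      unfolding \<kappa>[OF t] by (subst integral_mult_right_zero[symmetric]) (simp add: mult_ac)
    finally have L: "(LINT p|ou_measure \<rho>. D t p * \<psi> p) = ?L t"
      by (simp add: algebra_simps)
    have "ennreal (cmod (?L t)) \<le> (\<integral>\<^sup>+ p. ennreal (cmod (D t p)) * ennreal (cmod (\<psi> p)) \<partial>ou_measure \<rho>)"
      unfolding L[symmetric] using integral_norm_bound_ennreal[OF int_D] by (simp add: norm_mult ennreal_mult)
    then have "(ennreal (cmod (?L t)))\<^sup>2 \<le> (\<integral>\<^sup>+ p. ennreal (cmod (D t p)) * ennreal (cmod (\<psi> p)) \<partial>ou_measure \<rho>)\<^sup>2"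
      by (rule power_mono) simp
    also have "\<dots> \<le> (\<integral>\<^sup>+ p. (ennreal (cmod (D t p)))\<^sup>2 \<partial>ou_measure \<rho>) * (\<integral>\<^sup>+ p. (ennreal (cmod (\<psi> p)))\<^sup>2 \<partial>ou_measure \<rho>)"
      by (rule Cauchy_Schwarz_nn_integral) measurable
    also have "\<dots> = I * A t" by (simp add: A_def I_def ennreal_power mult.commute)
    finally show ?thesis by (simp add: ennreal_power)
  qed
  have "((\<lambda>t. I * A t) \<longlongrightarrow> I * 0) (at_right 0)"
    using I A0 by (intro ennreal_tendsto_cmult) auto
  then have lim: "((\<lambda>t. I * A t) \<longlongrightarrow> 0) (at_right 0)" by simp
  have "((\<lambda>t. ennreal ((cmod (?L t))\<^sup>2)) \<longlongrightarrow> 0) (at_right 0)"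
  proof (rule tendsto_sandwich[OF _ _ tendsto_const lim])
    show "\<forall>\<^sub>F t in at_right 0. ennreal ((cmod (?L t))\<^sup>2) \<le> I * A t"
      using eventually_at_right_less[of 0] by (rule eventually_mono) (rule bound)
  qed simp
  moreover have "((\<lambda>t. ennreal ((cmod (?L t))\<^sup>2)) \<longlongrightarrow> ennreal ((cmod (\<kappa> * ?F - ?G))\<^sup>2)) (at_right 0)"
    by (intro tendsto_ennrealI tendsto_intros exp_difference_quotient_tendsto)
  ultimately have "ennreal ((cmod (\<kappa> * ?F - ?G))\<^sup>2) = 0"
    using tendsto_unique trivial_limit_at_right_real by blast
  then show ?thesis by simp
qed

lemma ou_eigenvalue_minus: "ou_eigenvalue r (- \<Omega>) k l = ou_eigenvalue r \<Omega> l k"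
  by (simp add: ou_eigenvalue_def algebra_simps)

lemma ou_eigenvalue_inj:
  assumes "r > 0" "\<Omega> \<noteq> 0" "ou_eigenvalue r \<Omega> m n = ou_eigenvalue r \<Omega> k l"
  shows "m = k \<and> n = l"
proof -
  have "Re (ou_eigenvalue r \<Omega> m n) = Re (ou_eigenvalue r \<Omega> k l)" "Im (ou_eigenvalue r \<Omega> m n) = Im (ou_eigenvalue r \<Omega> k l)"
    using assms(3) by simp_all
  then have "real m + real n = real k + real l" "real m - real n = real k - real l"
    using assms(1,2) by (auto simp: ou_eigenvalue_def)
  then show ?thesis by linarith
qed

text \<open>The same pairing is multiplied by the eigenvalue of (m, n) through \<open>f\<close>, and
  by that of (l, k) through \<open>J \<rho> k l\<close>, because reversing \<Omega> exchanges the
  indices. Distinct eigenvalues force it to vanish.\<close>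

lemma ou_eigenfunction_orthogonal:
  assumes gen: "ou_generator r \<Omega> \<rho> f (\<lambda>p. ou_eigenvalue r \<Omega> m n * f p)"
    and pos: "r > 0" "\<rho> > 0" "\<Omega> \<noteq> 0" and neq: "(k, l) \<noteq> (n, m)"
  shows "(LINT p|ou_measure \<rho>. f p * J \<rho> k l p) = 0"
proof -
  have "ou_eigenvalue r \<Omega> m n * (LINT p|ou_measure \<rho>. f p * J \<rho> k l p) =
      ou_eigenvalue r \<Omega> l k * (LINT p|ou_measure \<rho>. f p * J \<rho> k l p)"
    using ou_generator_pairing[OF gen poly_growth_J pos(1,2) ou_semigroup_J[OF pos(1,2), of _ "- \<Omega>"], of k l]
    by (simp add: ou_eigenvalue_minus mult.assoc)
  then show ?thesis
    using ou_eigenvalue_inj[OF pos(1,3), of m n l k] neq by auto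
qed

text \<open>The exponent budget: powers and exponentials of linear growth cost 1/(8\<rho>), so the
  square of v carries at most 2(1/(4\<rho>) + 1/(8\<rho>)) = 3/(4\<rho>). Of the exponent 1/\<rho>
  of \<mu> there remains 1/(4\<rho>), a Gaussian with parameter 4\<rho>.\<close>

lemma L2_mu_of_bound:
  assumes [measurable]: "v \<in> borel_measurable borel" and \<rho>: "\<rho> > 0"
    and bound: "\<And>q. cmod (v q) \<le> (1 + norm q) ^ N * exp (M * norm q) * exp ((norm q)\<^sup>2 / (4 * \<rho>))"
  shows "v \<in> L2_mu \<rho>"
proof -
  define C where "C = exp ((real N + M)\<^sup>2 / (4 * (1 / (8 * \<rho>))))"
  have "norm (gauss \<rho> q *\<^sub>R (cmod (v q))\<^sup>2) \<le> norm (4 * C\<^sup>2 * gauss (4 * \<rho>) q)" for q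
  proof -
    have "cmod (v q) \<le> C * exp (1 / (8 * \<rho>) * (norm q)\<^sup>2) * exp ((norm q)\<^sup>2 / (4 * \<rho>))"
      using power_exp_le_exp_square[of "1 / (8 * \<rho>)" "norm q" N M] \<rho>
      by (intro order_trans[OF bound] mult_right_mono) (auto simp: C_def)
    then have "(cmod (v q))\<^sup>2 \<le> (C * exp (1 / (8 * \<rho>) * (norm q)\<^sup>2) * exp ((norm q)\<^sup>2 / (4 * \<rho>)))\<^sup>2"
      by (rule power_mono) simp
    also have "\<dots> = C\<^sup>2 * exp (3 * (norm q)\<^sup>2 / (4 * \<rho>))"
      using \<rho> by (simp add: power_mult_distrib field_simps flip: exp_add exp_double)
    finally have "gauss \<rho> q * (cmod (v q))\<^sup>2 \<le> gauss \<rho> q * (C\<^sup>2 * exp (3 * (norm q)\<^sup>2 / (4 * \<rho>)))"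
      using gauss_nonneg[OF \<rho>] by (rule mult_left_mono)
    also have "\<dots> = C\<^sup>2 / (pi * \<rho>) * (exp (- (norm q)\<^sup>2 / \<rho>) * exp (3 * (norm q)\<^sup>2 / (4 * \<rho>)))"
      by (simp add: gauss_def)
    also have "exp (- (norm q)\<^sup>2 / \<rho>) * exp (3 * (norm q)\<^sup>2 / (4 * \<rho>)) = exp (- (norm q)\<^sup>2 / (4 * \<rho>))"
      using \<rho> by (simp add: field_simps flip: exp_add)
    also have "C\<^sup>2 / (pi * \<rho>) * exp (- (norm q)\<^sup>2 / (4 * \<rho>)) = 4 * C\<^sup>2 * gauss (4 * \<rho>) q"
      using \<rho> by (simp add: gauss_def)
    finally show ?thesis
      using gauss_nonneg[OF \<rho>, of q] gauss_nonneg[of "4 * \<rho>" q] \<rho> by (simp add: abs_mult)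
  qed
  note le = this
  have "integrable lborel (\<lambda>q. gauss \<rho> q *\<^sub>R (cmod (v q))\<^sup>2)"
  proof (rule Bochner_Integration.integrable_bound)
    show "integrable lborel (\<lambda>q. 4 * C\<^sup>2 * gauss (4 * \<rho>) q)"
      using integrable_gauss[of "4 * \<rho>"] \<rho> by simp
    show "AE q in lborel. norm (gauss \<rho> q *\<^sub>R (cmod (v q))\<^sup>2) \<le> norm (4 * C\<^sup>2 * gauss (4 * \<rho>) q)"
      by (intro AE_I2 le)
  qed measurable
  then show ?thesis
    using \<rho> by (simp add: L2_mu_def integrable_ou_measure)
qed

lemma exp_partial_sum_le:
  fixes x :: real
  assumes "x \<ge> 0"
  shows "(\<Sum>i<N. x ^ i / fact i) \<le> exp x"
proof -
  have eq: "(\<lambda>i. x ^ i / fact i) = (\<lambda>i. x ^ i /\<^sub>R fact i)"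
    by (simp add: fun_eq_iff divide_inverse mult.commute)
  show ?thesis
    unfolding exp_def eq using assms by (intro sum_le_suminf summable_exp_generic) auto
qed

text \<open>Dominated convergence for the partial sums of the exponential series. The integrable
  function |v| exp|u| serves twice: it dominates all partial sums, and through |u|^i \<le> i! exp|u|
  it makes each term integrable.\<close>

lemma integral_exp_eq_0:
  fixes v u :: "'a \<Rightarrow> complex"
  assumes [measurable]: "v \<in> borel_measurable M" "u \<in> borel_measurable M"
    and int: "integrable M (\<lambda>x. v x * complex_of_real (exp (cmod (u x))))"
    and zero: "\<And>i. (LINT x|M. v x * u x ^ i) = 0"
  shows "(LINT x|M. v x * exp (u x)) = 0"
proof -
  define s where "s N x = (\<Sum>i<N. v x * u x ^ i / fact i)" for N x
  have le: "cmod (\<Sum>i\<in>I. v x * u x ^ i / fact i) \<le> cmod (v x) * (\<Sum>i\<in>I. cmod (u x) ^ i / fact i)" for I x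
    by (rule order_trans[OF norm_sum]) (simp add: norm_mult norm_divide norm_power sum_distrib_left)
  have int_i: "integrable M (\<lambda>x. v x * u x ^ i)" for i
  proof (rule Bochner_Integration.integrable_bound)
    show "integrable M (\<lambda>x. fact i * (v x * complex_of_real (exp (cmod (u x)))))"
      using int by simp
    have "cmod (v x * u x ^ i) \<le> cmod (fact i * (v x * complex_of_real (exp (cmod (u x)))))" for x
    proof -
      have "cmod (u x) ^ i / fact i \<le> (\<Sum>i<Suc i. cmod (u x) ^ i / fact i)"
        by (rule member_le_sum) auto
      also have "\<dots> \<le> exp (cmod (u x))" by (rule exp_partial_sum_le) simp
      finally have "cmod (u x) ^ i \<le> fact i * exp (cmod (u x))" by (simp add: field_simps)
      from mult_left_mono[OF this, of "cmod (v x)"] show ?thesis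
        by (simp add: norm_mult norm_power mult.left_commute)
    qed
    then show "AE x in M. cmod (v x * u x ^ i) \<le> cmod (fact i * (v x * complex_of_real (exp (cmod (u x)))))"
      by simp
  qed measurable
  have "(\<lambda>N. integral\<^sup>L M (s N)) \<longlonglongrightarrow> (LINT x|M. v x * exp (u x))"
  proof (rule integral_dominated_convergence)
    show "integrable M (\<lambda>x. cmod (v x * complex_of_real (exp (cmod (u x)))))"
      using int by (rule integrable_norm)
    show "AE x in M. (\<lambda>N. s N x) \<longlonglongrightarrow> v x * exp (u x)"
    proof (intro AE_I2)
      fix x
      have "(\<lambda>i. v x * (u x ^ i /\<^sub>R fact i)) sums (v x * exp (u x))"
        by (intro sums_mult exp_converges)
      then show "(\<lambda>N. s N x) \<longlonglongrightarrow> v x * exp (u x)"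
        unfolding sums_def s_def by (simp add: scaleR_conv_of_real field_simps)
    qed
    have "cmod (s N x) \<le> cmod (v x * complex_of_real (exp (cmod (u x))))" for N x
      unfolding s_def by (rule order_trans[OF le]) (simp add: norm_mult mult_left_mono exp_partial_sum_le)
    then show "AE x in M. cmod (s N x) \<le> cmod (v x * complex_of_real (exp (cmod (u x))))" for N
      by simp
  qed (unfold s_def, measurable)
  moreover have "integral\<^sup>L M (s N) = 0" for N
    unfolding s_def using int_i zero by (subst Bochner_Integration.integral_sum) auto
  ultimately show ?thesis by (auto simp: LIMSEQ_const_iff)
qed

section \<open>From orthogonality to polynomials to orthogonality to Gaussian exponentials\<close>

context
  fixes \<rho> :: real and h :: "real \<times> real \<Rightarrow> complex"
  assumes \<rho>: "\<rho> > 0" and h: "h \<in> L2_mu \<rho>"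
    and orth: "\<And>k l. (LINT p|ou_measure \<rho>. h p * J \<rho> k l p) = 0"
begin

text \<open>The mechanism by which an exponential factor is adjoined: vanishing moments in
  \<open>u\<close> suffice as long as |v| exp|u| stays within the budget of
  \<open>L\<^sup>2(\<mu>)\<close>.\<close>

lemma orth_exp:
  assumes [measurable]: "v \<in> borel_measurable borel" "u \<in> borel_measurable borel"
    and bound: "\<And>q. cmod (v q) * exp (cmod (u q)) \<le>
        (1 + norm q) ^ N * exp (M * norm q) * exp ((norm q)\<^sup>2 / (4 * \<rho>))"
    and zero: "\<And>i. (LINT p|ou_measure \<rho>. h p * (v p * u p ^ i)) = 0"
  shows "(LINT p|ou_measure \<rho>. h p * (v p * exp (u p))) = 0"
proof -
  note [measurable] = L2_mu_measurable[OF h]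
  have "(\<lambda>p. v p * complex_of_real (exp (cmod (u p)))) \<in> L2_mu \<rho>"
    by (rule L2_mu_of_bound[OF _ \<rho>]) (use bound in \<open>auto simp: norm_mult\<close>)
  from L2_mu_mult_integrable[OF h this] zero
  have "(LINT p|ou_measure \<rho>. (h p * v p) * exp (u p)) = 0"
    by (intro integral_exp_eq_0) (auto simp: mult.assoc)
  then show ?thesis by (simp add: mult.assoc)
qed

text \<open>The induction runs over the mixed products of z^a with a Hermite polynomial. The
  recurrence replaces one factor z by Hermite polynomials with indices (k + 1, b) and (k, b - 1),
  and index k = 0 gives the pure power of w.\<close>

lemma orth_monomial: "(LINT p|ou_measure \<rho>. h p * (cplx p ^ a * cnj (cplx p) ^ b)) = 0"
proof -
  have int: "integrable (ou_measure \<rho>) (\<lambda>p. h p * (cplx p ^ a * planeherm (- complex_of_real \<rho>) k b p))" for a k b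
    by (intro L2_mu_mult_integrable h poly_growth_in_L2 \<rho> poly_growth_intros)
  have "(LINT p|ou_measure \<rho>. h p * (cplx p ^ a * planeherm (- complex_of_real \<rho>) k b p)) = 0" for a k b
  proof (induction a arbitrary: k b)
    case 0
    then show ?case using orth[of k b] by (simp add: J_eq_planeherm)
  next
    case (Suc a)
    have "h p * (cplx p ^ Suc a * planeherm (- complex_of_real \<rho>) k b p) =
        h p * (cplx p ^ a * planeherm (- complex_of_real \<rho>) (Suc k) b p) +
        (complex_of_real \<rho> * of_nat b) * (h p * (cplx p ^ a * planeherm (- complex_of_real \<rho>) k (b - 1) p))" for p
      by (simp add: cherm_Suc_left algebra_simps)
    then show ?case
      using int Suc.IH by simp
  qed
  from this[of a 0 b] show ?thesis by simp
qed

text \<open>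
  The power series of \<open>exp (- \<delta>|q|\<^sup>2)\<close> may be integrated term by term against \<open>h\<close> only for
  small \<open>\<delta>\<close>: its majorant \<open>exp (\<delta>|q|\<^sup>2)\<close> has to lie in \<open>L\<^sup>2(\<mu>)\<close>. The factor \<open>exp (- a|q|\<^sup>2)\<close> is therefore
  reached in \<open>N\<close> steps of size \<open>a / N\<close>.
\<close>

lemma orth_monomial_gauss:
  assumes "a \<ge> 0"
  shows "(LINT p|ou_measure \<rho>. h p * (cplx p ^ k * cnj (cplx p) ^ l * complex_of_real (exp (- a * (norm p)\<^sup>2)))) = 0"
proof -
  obtain N :: nat where N: "a * 4 * \<rho> < real N" using reals_Archimedean2 by blast
  then have N0: "real N > 0" using assms \<rho> by (smt (verit) mult_nonneg_nonneg)
  define \<delta> where "\<delta> = a / real N"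
  have \<delta>: "0 \<le> \<delta>" "\<delta> \<le> 1 / (4 * \<rho>)"
    using assms N N0 \<rho> by (auto simp: \<delta>_def field_simps)
  have "(LINT p|ou_measure \<rho>. h p * (cplx p ^ k * cnj (cplx p) ^ l * complex_of_real (exp (- (real j * \<delta>) * (norm p)\<^sup>2)))) = 0" for j k l
  proof (induction j arbitrary: k l)
    case 0
    then show ?case by (simp add: orth_monomial)
  next
    case (Suc j)
    let ?v = "\<lambda>p. cplx p ^ k * cnj (cplx p) ^ l * complex_of_real (exp (- (real j * \<delta>) * (norm p)\<^sup>2))"
    let ?u = "\<lambda>p. complex_of_real (- \<delta> * (norm p)\<^sup>2)"
    have "(LINT p|ou_measure \<rho>. h p * (?v p * exp (?u p))) = 0"
    proof (rule orth_exp)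
      show "cmod (?v q) * exp (cmod (?u q)) \<le> (1 + norm q) ^ (k + l) * exp (0 * norm q) * exp ((norm q)\<^sup>2 / (4 * \<rho>))" for q
      proof -
        have "cmod (?v q) \<le> norm q ^ (k + l) * 1"
          using \<delta>(1) by (simp add: norm_mult norm_power power_add mult_left_le)
        also have "\<dots> \<le> (1 + norm q) ^ (k + l)" by (simp add: power_mono)
        finally have 1: "cmod (?v q) \<le> (1 + norm q) ^ (k + l)" .
        have "cmod (?u q) = \<delta> * (norm q)\<^sup>2" using \<delta>(1) by (simp only: norm_of_real) simp
        also have "\<dots> \<le> 1 / (4 * \<rho>) * (norm q)\<^sup>2" using \<delta>(2) by (rule mult_right_mono) simp
        finally have "exp (cmod (?u q)) \<le> exp ((norm q)\<^sup>2 / (4 * \<rho>))" by simp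
        with 1 show ?thesis by (intro mult_mono) auto
      qed
      fix i
      have nn: "complex_of_real ((norm p)\<^sup>2) = cplx p * cnj (cplx p)" for p
        by (simp add: complex_norm_square[symmetric] del: of_real_power)
      \<comment> \<open>Since |p|^2 = z w, the i-th power of \<open>u\<close> only raises both
        exponents by i. This is why the induction hypothesis must hold for all k and l.\<close>
      have u: "?u p = - complex_of_real \<delta> * (cplx p * cnj (cplx p))" for p
        by (simp only: of_real_mult of_real_minus nn)
      have "h p * (?v p * ?u p ^ i) = (- complex_of_real \<delta>) ^ i *
         (h p * (cplx p ^ (k + i) * cnj (cplx p) ^ (l + i) * complex_of_real (exp (- (real j * \<delta>) * (norm p)\<^sup>2))))" for p
        unfolding u power_mult_distrib power_add by (simp only: mult_ac)
      then show "(LINT p|ou_measure \<rho>. h p * (?v p * ?u p ^ i)) = 0"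
        by (simp only: integral_mult_right_zero Suc.IH mult_zero_right)
    qed (intro borel_measurable_continuous_onI continuous_intros)+
    moreover have "?v p * exp (?u p) = cplx p ^ k * cnj (cplx p) ^ l * complex_of_real (exp (- (real (Suc j) * \<delta>) * (norm p)\<^sup>2))" for p
    proof -
      have "exp (- (real j * \<delta>) * (norm p)\<^sup>2) * exp (- \<delta> * (norm p)\<^sup>2) = exp (- (real (Suc j) * \<delta>) * (norm p)\<^sup>2)"
        by (simp add: algebra_simps flip: exp_add)
      then show ?thesis
        by (simp only: exp_of_real of_real_mult mult.assoc flip: of_real_mult)
    qed
    ultimately show ?case by (simp only:)
  qed
  from this[of k l N] show ?thesis using N0 by (simp add: \<delta>_def)
qed

text \<open>The two exponentials are adjoined one after the other. Their majorants grow only like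
  exponentials of a multiple of |q|, so each takes a single application, whatever the size of
  \<alpha> and \<beta>.\<close>

lemma orth_gauss_exp:
  assumes "a \<ge> 0"
  shows "(LINT p|ou_measure \<rho>. h p * (complex_of_real (exp (- a * (norm p)\<^sup>2)) * exp (\<alpha> * cplx p) * exp (\<beta> * cnj (cplx p)))) = 0"
proof -
  let ?g = "\<lambda>p. complex_of_real (exp (- a * (norm p)\<^sup>2))"
  have g: "cmod (?g q) \<le> 1" for q using assms by simp
  have 1: "1 \<le> exp ((norm q)\<^sup>2 / (4 * \<rho>))" for q using \<rho> by simp
  \<comment> \<open>The power of w is kept because the expansion of the second exponential asks for
    every such moment.\<close>
  have T: "(LINT p|ou_measure \<rho>. h p * (cnj (cplx p) ^ l * ?g p * exp (\<alpha> * cplx p))) = 0" for l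
  proof (rule orth_exp)
    show "cmod (cnj (cplx q) ^ l * ?g q) * exp (cmod (\<alpha> * cplx q)) \<le>
        (1 + norm q) ^ l * exp (cmod \<alpha> * norm q) * exp ((norm q)\<^sup>2 / (4 * \<rho>))" for q
    proof -
      have "cmod (cnj (cplx q) ^ l * ?g q) \<le> (1 + norm q) ^ l * 1"
        unfolding norm_mult by (intro mult_mono g) (auto simp: norm_power power_mono)
      then have "cmod (cnj (cplx q) ^ l * ?g q) * exp (cmod (\<alpha> * cplx q)) * 1 \<le>
         (1 + norm q) ^ l * exp (cmod \<alpha> * norm q) * exp ((norm q)\<^sup>2 / (4 * \<rho>))"
        by (intro mult_mono 1) (auto simp: norm_mult)
      then show ?thesis by simp
    qed
    fix i
    have "h p * (cnj (cplx p) ^ l * ?g p * (\<alpha> * cplx p) ^ i) =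
        \<alpha> ^ i * (h p * (cplx p ^ i * cnj (cplx p) ^ l * ?g p))" for p
      by (simp add: power_mult_distrib mult_ac)
    then show "(LINT p|ou_measure \<rho>. h p * (cnj (cplx p) ^ l * ?g p * (\<alpha> * cplx p) ^ i)) = 0"
      by (simp only: integral_mult_right_zero orth_monomial_gauss[OF assms] mult_zero_right)
  qed (intro borel_measurable_continuous_onI continuous_intros)+
  show ?thesis
  proof (rule orth_exp)
    show "cmod (?g q * exp (\<alpha> * cplx q)) * exp (cmod (\<beta> * cnj (cplx q))) \<le>
        (1 + norm q) ^ 0 * exp ((cmod \<alpha> + cmod \<beta>) * norm q) * exp ((norm q)\<^sup>2 / (4 * \<rho>))" for q
    proof -
      have "cmod (exp (\<alpha> * cplx q)) \<le> exp (cmod \<alpha> * norm q)"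
        using norm_exp[of "\<alpha> * cplx q"] by (simp add: norm_mult)
      with g have "cmod (?g q * exp (\<alpha> * cplx q)) \<le> 1 * exp (cmod \<alpha> * norm q)"
        unfolding norm_mult by (intro mult_mono) auto
      then have "cmod (?g q * exp (\<alpha> * cplx q)) * exp (cmod (\<beta> * cnj (cplx q))) * 1 \<le>
         exp (cmod \<alpha> * norm q) * exp (cmod \<beta> * norm q) * exp ((norm q)\<^sup>2 / (4 * \<rho>))"
        by (intro mult_mono 1) (auto simp: norm_mult)
      then show ?thesis by (simp add: distrib_right exp_add)
    qed
    fix i
    have "h p * (?g p * exp (\<alpha> * cplx p) * (\<beta> * cnj (cplx p)) ^ i) =
        \<beta> ^ i * (h p * (cnj (cplx p) ^ i * ?g p * exp (\<alpha> * cplx p)))" for p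
      by (simp add: power_mult_distrib mult_ac)
    then show "(LINT p|ou_measure \<rho>. h p * (?g p * exp (\<alpha> * cplx p) * (\<beta> * cnj (cplx p)) ^ i)) = 0"
      by (simp only: integral_mult_right_zero T mult_zero_right)
  qed (intro borel_measurable_continuous_onI continuous_intros)+
qed

end

section \<open>Uniqueness of eigenfunctions\<close>

text \<open>The transition kernel divided by the density of \<mu>. The cross term 2 Re(w cnj q)/s is
  split into a part linear in q and a part linear in its conjugate, which is the product of
  exponentials treated by \<open>orth_gauss_exp\<close>.\<close>

lemma gauss_diff_factorization:
  fixes w :: "real \<times> real"
  assumes s: "0 < s" and \<rho>: "0 < \<rho>"
  defines "v \<equiv> \<lambda>q. complex_of_real (\<rho> / s * exp (- (norm w)\<^sup>2 / s)) *
      (complex_of_real (exp (- (1 / s - 1 / \<rho>) * (norm q)\<^sup>2)) *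
        exp (cnj (cplx w) / complex_of_real s * cplx q) * exp (cplx w / complex_of_real s * cnj (cplx q)))"
  shows "complex_of_real (gauss s (w - q)) = gauss \<rho> q *\<^sub>R v q"
proof -
  define c where "c = Re (cplx w * cnj (cplx q))"
  have sq: "(norm (w - q))\<^sup>2 = (norm w)\<^sup>2 + (norm q)\<^sup>2 - 2 * c"
    unfolding norm_cplx[symmetric] cplx_diff c_def
    by (simp only: cmod_power2) (simp add: power2_eq_square algebra_simps)
  have "cnj (cplx w) * cplx q + cplx w * cnj (cplx q) = complex_of_real (2 * c)"
    by (simp add: c_def complex_eq_iff algebra_simps)
  then have "cnj (cplx w) / complex_of_real s * cplx q + cplx w / complex_of_real s * cnj (cplx q) = complex_of_real (2 * c / s)"
    using s by (simp add: field_simps)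
  then have e: "exp (cnj (cplx w) / complex_of_real s * cplx q) * exp (cplx w / complex_of_real s * cnj (cplx q)) = complex_of_real (exp (2 * c / s))"
    by (simp only: exp_add[symmetric] exp_of_real)
  have "v q = complex_of_real (\<rho> / s * exp (- (norm w)\<^sup>2 / s) * (exp (- (1 / s - 1 / \<rho>) * (norm q)\<^sup>2) * exp (2 * c / s)))"
    unfolding v_def mult.assoc e by (simp only: of_real_mult mult.assoc)
  moreover have "gauss s (w - q) = gauss \<rho> q * (\<rho> / s * exp (- (norm w)\<^sup>2 / s) * (exp (- (1 / s - 1 / \<rho>) * (norm q)\<^sup>2) * exp (2 * c / s)))"
  proof -
    have "- (norm (w - q))\<^sup>2 / s = - (norm q)\<^sup>2 / \<rho> + (- (norm w)\<^sup>2 / s + (- (1 / s - 1 / \<rho>) * (norm q)\<^sup>2 + 2 * c / s))"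
      unfolding sq using s \<rho> by (simp add: field_simps)
    then have "exp (- (norm (w - q))\<^sup>2 / s) = exp (- (norm q)\<^sup>2 / \<rho>) * (exp (- (norm w)\<^sup>2 / s) * (exp (- (1 / s - 1 / \<rho>) * (norm q)\<^sup>2) * exp (2 * c / s)))"
      by (simp only: exp_add)
    then show ?thesis
      using s \<rho> unfolding gauss_def by (simp add: mult_ac)
  qed
  ultimately show ?thesis
    by (simp only: scaleR_conv_of_real of_real_mult)
qed

lemma ou_variance_less:
  assumes "\<rho> > 0"
  shows "ou_variance r \<rho> t < \<rho>"
  using assms by (simp add: ou_variance_def)

lemma ou_variance_inverse_diff:
  assumes "r > 0" "\<rho> > 0" "t > 0"
  shows "0 \<le> 1 / ou_variance r \<rho> t - 1 / \<rho>"
  using ou_variance_pos[OF assms] ou_variance_less[OF assms(2), of r t] by (simp add: frac_le)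

lemma ou_semigroup_eq_0:
  assumes "\<rho> > 0" "h \<in> L2_mu \<rho>" "\<And>k l. (LINT p|ou_measure \<rho>. h p * J \<rho> k l p) = 0"
    and "r > 0" "t > 0"
  shows "ou_semigroup r \<Omega> \<rho> t h p = 0"
proof -
  define s where "s = ou_variance r \<rho> t"
  have s: "s > 0" unfolding s_def using assms by (intro ou_variance_pos)
  define w where "w = exp_flow (drift r \<Omega>) t p"
  define K where "K = complex_of_real (\<rho> / s * exp (- (norm w)\<^sup>2 / s))"
  define v where "v = (\<lambda>q. complex_of_real (exp (- (1 / s - 1 / \<rho>) * (norm q)\<^sup>2)) *
        exp (cnj (cplx w) / complex_of_real s * cplx q) * exp (cplx w / complex_of_real s * cnj (cplx q)))"
  have [measurable]: "h \<in> borel_measurable borel" using assms(2) by (rule L2_mu_measurable)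
  have [measurable]: "v \<in> borel_measurable borel"
    unfolding v_def by (intro borel_measurable_continuous_onI continuous_intros)
  have "gauss s (w - q) *\<^sub>R h q = K * (gauss \<rho> q *\<^sub>R (h q * v q))" for q
    using gauss_diff_factorization[OF s assms(1), of w q]
    unfolding scaleR_conv_of_real[of "gauss s (w - q)"] by (simp add: K_def v_def mult_ac)
  then have "ou_semigroup r \<Omega> \<rho> t h p = K * (LINT q|lborel. gauss \<rho> q *\<^sub>R (h q * v q))"
    by (simp add: ou_semigroup_kernel s_def[symmetric] w_def[symmetric] del: mult_scaleR_right)
  also have "(LINT q|lborel. gauss \<rho> q *\<^sub>R (h q * v q)) = (LINT q|ou_measure \<rho>. h q * v q)"
    using assms(1) by (subst integral_ou_measure) auto
  also have "\<dots> = 0"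
    unfolding v_def using assms ou_variance_inverse_diff[OF assms(4,1,5)]
    by (intro orth_gauss_exp) (simp_all add: s_def)
  finally show ?thesis by simp
qed

text \<open>The kernel relative to \<mu> lies in \<open>L\<^sup>2(\<mu>)\<close>: its quadratic
  exponent is not positive because s < \<rho>, and the rest has linear exponents. Integrability is
  what makes \<open>P\<^sub>t\<close> additive, as a divergent Bochner integral would count as
  0.\<close>

lemma ou_semigroup_integrable:
  assumes f: "f \<in> L2_mu \<rho>" and pos: "r > 0" "\<rho> > 0" "t > 0"
  shows "integrable lborel (\<lambda>q. gauss (ou_variance r \<rho> t) (w - q) *\<^sub>R f q)"
proof -
  define s where "s = ou_variance r \<rho> t"
  have s: "s > 0" unfolding s_def using pos by (rule ou_variance_pos)
  have a: "0 \<le> 1 / s - 1 / \<rho>" unfolding s_def using pos by (rule ou_variance_inverse_diff)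
  define K where "K = complex_of_real (\<rho> / s * exp (- (norm w)\<^sup>2 / s))"
  define v where "v = (\<lambda>q. complex_of_real (exp (- (1 / s - 1 / \<rho>) * (norm q)\<^sup>2)) *
        exp (cnj (cplx w) / complex_of_real s * cplx q) * exp (cplx w / complex_of_real s * cnj (cplx q)))"
  have [measurable]: "f \<in> borel_measurable borel" using f by (rule L2_mu_measurable)
  have [measurable]: "v \<in> borel_measurable borel"
    unfolding v_def by (intro borel_measurable_continuous_onI continuous_intros)
  define M where "M = 2 * norm w / s"
  have "cmod (v q) \<le> (1 + norm q) ^ 0 * exp (M * norm q) * exp ((norm q)\<^sup>2 / (4 * \<rho>))" for q
  proof -
    have 1: "cmod (complex_of_real (exp (- (1 / s - 1 / \<rho>) * (norm q)\<^sup>2))) \<le> 1"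
    proof -
      have "0 \<le> (1 / s - 1 / \<rho>) * (norm q)\<^sup>2" using a by (intro mult_nonneg_nonneg) auto
      then have "- (1 / s - 1 / \<rho>) * (norm q)\<^sup>2 \<le> 0" by (simp only: mult_minus_left neg_le_0_iff_le)
      then show ?thesis by (simp only: norm_of_real abs_exp_cancel exp_le_one_iff)
    qed
    have 2: "cmod (exp (cnj (cplx w) / complex_of_real s * cplx q)) \<le> exp (norm w / s * norm q)"
      "cmod (exp (cplx w / complex_of_real s * cnj (cplx q))) \<le> exp (norm w / s * norm q)"
      using norm_exp[of "cnj (cplx w) / complex_of_real s * cplx q"]
        norm_exp[of "cplx w / complex_of_real s * cnj (cplx q)"] s
      by (simp_all add: norm_mult norm_divide)
    have "cmod (v q) \<le> 1 * exp (norm w / s * norm q) * exp (norm w / s * norm q)"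
      unfolding v_def norm_mult by (intro mult_mono 1 2) auto
    also have "\<dots> = exp (M * norm q)" by (simp add: M_def flip: exp_add)
    also have "\<dots> \<le> exp (M * norm q) * exp ((norm q)\<^sup>2 / (4 * \<rho>))" using pos by simp
    finally show ?thesis by simp
  qed
  then have "v \<in> L2_mu \<rho>" using pos by (intro L2_mu_of_bound[where N = 0 and M = M]) auto
  from L2_mu_mult_integrable[OF f this] have "integrable lborel (\<lambda>q. gauss \<rho> q *\<^sub>R (f q * v q))"
    using pos by (subst (asm) integrable_ou_measure) auto
  then have "integrable lborel (\<lambda>q. K * (gauss \<rho> q *\<^sub>R (f q * v q)))"
    by (rule integrable_mult_right)
  moreover have "gauss s (w - q) *\<^sub>R f q = K * (gauss \<rho> q *\<^sub>R (f q * v q))" for q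
    using gauss_diff_factorization[OF s pos(2), of w q]
    unfolding scaleR_conv_of_real[of "gauss s (w - q)"] by (simp add: K_def v_def mult_ac)
  ultimately show ?thesis unfolding s_def[symmetric] by simp
qed

lemma ou_semigroup_diff_cmult:
  assumes f: "f \<in> L2_mu \<rho>" and g: "g \<in> L2_mu \<rho>" and pos: "r > 0" "\<rho> > 0" "t > 0"
  shows "ou_semigroup r \<Omega> \<rho> t (\<lambda>q. f q - c * g q) p = ou_semigroup r \<Omega> \<rho> t f p - c * ou_semigroup r \<Omega> \<rho> t g p"
proof -
  note [measurable] = L2_mu_measurable[OF f] L2_mu_measurable[OF g]
  let ?G = "\<lambda>q. gauss (ou_variance r \<rho> t) (exp_flow (drift r \<Omega>) t p - q)"
  have "?G q *\<^sub>R (f q - c * g q) = ?G q *\<^sub>R f q - c * (?G q *\<^sub>R g q)" for q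
    by (simp add: scaleR_diff_right)
  then show ?thesis
    using ou_semigroup_integrable[OF f pos] ou_semigroup_integrable[OF g pos]
    by (simp add: ou_semigroup_kernel del: mult_scaleR_right)
qed

section \<open>Linearity of the generator and the one-dimensional eigenspace\<close>

lemma cmod_diff_power2_le: "(cmod (a - b))\<^sup>2 \<le> 2 * (cmod a)\<^sup>2 + 2 * (cmod b)\<^sup>2"
proof -
  have "(cmod (a - b))\<^sup>2 \<le> (cmod a + cmod b)\<^sup>2"
    by (intro power_mono norm_triangle_ineq4) simp
  also have "\<dots> \<le> 2 * (cmod a)\<^sup>2 + 2 * (cmod b)\<^sup>2"
    using sum_squares_bound[of "cmod a" "cmod b"] by (simp add: power2_sum)
  finally show ?thesis .
qed

lemma L2_mu_diff:
  assumes f: "f \<in> L2_mu \<rho>" and g: "g \<in> L2_mu \<rho>"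
  shows "(\<lambda>p. f p - g p) \<in> L2_mu \<rho>"
proof -
  note [measurable] = L2_mu_measurable[OF f] L2_mu_measurable[OF g]
  have "integrable (ou_measure \<rho>) (\<lambda>p. (cmod (f p - g p))\<^sup>2)"
  proof (rule Bochner_Integration.integrable_bound)
    show "integrable (ou_measure \<rho>) (\<lambda>p. 2 * (cmod (f p))\<^sup>2 + 2 * (cmod (g p))\<^sup>2)"
      using f g by (simp add: L2_mu_def)
  qed (use cmod_diff_power2_le in \<open>auto\<close>)
  then show ?thesis by (simp add: L2_mu_def)
qed

text \<open>The generator is phrased with squared norms, so |a - b|^2 \<le> 2|a|^2 + 2|b|^2 takes
  the place of the triangle inequality; hence the factors 2 and 2|c|^2.\<close>

lemma ou_generator_diff_cmult:
  assumes f: "ou_generator r \<Omega> \<rho> f f'" and g: "ou_generator r \<Omega> \<rho> g g'" and pos: "r > 0" "\<rho> > 0"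
  shows "ou_generator r \<Omega> \<rho> (\<lambda>p. f p - c * g p) (\<lambda>p. f' p - c * g' p)"
proof -
  have L2: "f \<in> L2_mu \<rho>" "f' \<in> L2_mu \<rho>" "g \<in> L2_mu \<rho>" "g' \<in> L2_mu \<rho>"
    using f g by (auto simp: ou_generator_def)
  note [measurable] = L2[THEN L2_mu_measurable]
  define D where "D f f' t p = (ou_semigroup r \<Omega> \<rho> t f p - f p) /\<^sub>R t - f' p" for f f' :: "real \<times> real \<Rightarrow> complex" and t p
  define A where "A f f' t = (\<integral>\<^sup>+ p. ennreal ((cmod (D f f' t p))\<^sup>2) \<partial>ou_measure \<rho>)" for f f' :: "real \<times> real \<Rightarrow> complex" and t
  have [measurable]: "D f f' t \<in> borel_measurable borel" "D g g' t \<in> borel_measurable borel" for t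
    unfolding D_def by measurable
  have lim: "(A f f' \<longlongrightarrow> 0) (at_right 0)" "(A g g' \<longlongrightarrow> 0) (at_right 0)"
    using f g unfolding ou_generator_def A_def D_def by auto
  have bound: "A (\<lambda>p. f p - c * g p) (\<lambda>p. f' p - c * g' p) t \<le> ennreal 2 * A f f' t + ennreal (2 * (cmod c)\<^sup>2) * A g g' t"
    if t: "t > 0" for t
  proof -
    have D: "D (\<lambda>p. f p - c * g p) (\<lambda>p. f' p - c * g' p) t p = D f f' t p - c * D g g' t p" for p
      unfolding D_def ou_semigroup_diff_cmult[OF L2(1,3) pos t] by (simp add: algebra_simps)
    have "ennreal ((cmod (D f f' t p - c * D g g' t p))\<^sup>2) \<le>
       ennreal 2 * ennreal ((cmod (D f f' t p))\<^sup>2) + ennreal (2 * (cmod c)\<^sup>2) * ennreal ((cmod (D g g' t p))\<^sup>2)" for p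
      using cmod_diff_power2_le[of "D f f' t p" "c * D g g' t p"]
      by (simp add: norm_mult power_mult_distrib mult.assoc flip: ennreal_mult ennreal_plus del: ennreal_numeral)
    then have "A (\<lambda>p. f p - c * g p) (\<lambda>p. f' p - c * g' p) t \<le>
      (\<integral>\<^sup>+ p. ennreal 2 * ennreal ((cmod (D f f' t p))\<^sup>2) + ennreal (2 * (cmod c)\<^sup>2) * ennreal ((cmod (D g g' t p))\<^sup>2) \<partial>ou_measure \<rho>)"
      unfolding A_def D by (intro nn_integral_mono)
    also have "\<dots> = ennreal 2 * A f f' t + ennreal (2 * (cmod c)\<^sup>2) * A g g' t"
      unfolding A_def by (subst nn_integral_add) (simp_all add: nn_integral_cmult del: ennreal_numeral)
    finally show ?thesis .
  qed
  have "((\<lambda>t. ennreal 2 * A f f' t + ennreal (2 * (cmod c)\<^sup>2) * A g g' t) \<longlongrightarrow> ennreal 2 * 0 + ennreal (2 * (cmod c)\<^sup>2) * 0) (at_right 0)"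
    by (intro tendsto_add ennreal_tendsto_cmult lim) auto
  then have lim': "((\<lambda>t. ennreal 2 * A f f' t + ennreal (2 * (cmod c)\<^sup>2) * A g g' t) \<longlongrightarrow> 0) (at_right 0)" by simp
  have "(A (\<lambda>p. f p - c * g p) (\<lambda>p. f' p - c * g' p) \<longlongrightarrow> 0) (at_right 0)"
  proof (rule tendsto_sandwich[OF _ _ tendsto_const lim'])
    show "\<forall>\<^sub>F t in at_right 0. A (\<lambda>p. f p - c * g p) (\<lambda>p. f' p - c * g' p) t \<le> ennreal 2 * A f f' t + ennreal (2 * (cmod c)\<^sup>2) * A g g' t"
      using eventually_at_right_less[of 0] by (rule eventually_mono) (rule bound)
  qed simp
  then show ?thesis
    unfolding ou_generator_def A_def D_def
    using L2 by (auto intro: L2_mu_diff L2_mu_cmult)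
qed

lemma ou_generator_orthogonal_AE_0:
  assumes gen: "ou_generator r \<Omega> \<rho> h (\<lambda>p. c * h p)" and pos: "r > 0" "\<rho> > 0"
    and orth: "\<And>k l. (LINT p|ou_measure \<rho>. h p * J \<rho> k l p) = 0"
  shows "AE p in ou_measure \<rho>. h p = 0"
proof -
  have h: "h \<in> L2_mu \<rho>" using gen by (simp add: ou_generator_def)
  note [measurable] = L2_mu_measurable[OF h]
  define I where "I = (\<integral>\<^sup>+ p. ennreal ((cmod (h p))\<^sup>2) \<partial>ou_measure \<rho>)"
  let ?A = "\<lambda>t. \<integral>\<^sup>+ p. ennreal ((cmod ((ou_semigroup r \<Omega> \<rho> t h p - h p) /\<^sub>R t - c * h p))\<^sup>2) \<partial>ou_measure \<rho>"
  have "((\<lambda>t. ?A t) \<longlongrightarrow> 0) (at_right 0)" using gen by (simp add: ou_generator_def)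
  moreover have "\<forall>\<^sub>F t in at_right 0. I \<le> ?A t"
  proof -
    \<comment> \<open>As \<open>P\<^sub>t h = 0\<close>, the generator defect is -(1/t + c) h. Below
      this threshold |1/t + c| \<ge> 1/t - |c| \<ge> 1, so the defect is at least as large as
      \<open>h\<close> while tending to 0.\<close>
    have "\<forall>\<^sub>F t in at_right 0. t < 1 / (1 + cmod c)"
      by (rule eventually_at_right_real[THEN eventually_mono]) (auto simp: add_pos_nonneg)
    then show ?thesis
      using eventually_at_right_less[of 0]
    proof eventually_elim
      case (elim t)
      have "(ou_semigroup r \<Omega> \<rho> t h p - h p) /\<^sub>R t - c * h p = - ((complex_of_real (1 / t) + c) * h p)" for p
        unfolding ou_semigroup_eq_0[OF pos(2) h orth pos(1) elim(2)]
        by (simp add: scaleR_conv_of_real algebra_simps divide_inverse)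
      then have A: "?A t = ennreal ((cmod (complex_of_real (1 / t) + c))\<^sup>2) * I"
        unfolding I_def
        by (subst nn_integral_cmult[symmetric])
          (simp_all only: norm_minus_cancel norm_mult power_mult_distrib ennreal_mult zero_le_power2, measurable)
      have "1 + cmod c \<le> 1 / t"
        using elim by (simp add: field_simps add_pos_nonneg)
      then have "1 \<le> cmod (complex_of_real (1 / t) + c)"
        using norm_diff_ineq[of "complex_of_real (1 / t)" c] elim by (simp add: norm_divide)
      then have "1 \<le> ennreal ((cmod (complex_of_real (1 / t) + c))\<^sup>2)"
        by (simp add: one_le_power)
      then show ?case
        unfolding A using mult_right_mono[of 1 "ennreal ((cmod (complex_of_real (1 / t) + c))\<^sup>2)" I] by simp
    qed
  qed
  ultimately have "I \<le> 0"
    by (rule tendsto_lowerbound) simp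
  then have "AE p in ou_measure \<rho>. ennreal ((cmod (h p))\<^sup>2) = 0"
    unfolding I_def by (subst (asm) le_zero_eq, subst (asm) nn_integral_0_iff_AE) auto
  then show ?thesis by eventually_elim simp
qed

lemma J_swap: "J \<rho> n m p = cnj (J \<rho> m n p)"
  unfolding J_eq_planeherm by (simp add: cnj_cherm) (rule cherm_swap)

lemma ou_eigenfunction_unique:
  assumes gen: "ou_generator r \<Omega> \<rho> f (\<lambda>p. ou_eigenvalue r \<Omega> m n * f p)"
    and pos: "r > 0" "\<rho> > 0" "\<Omega> \<noteq> 0"
  shows "\<exists>c. AE p in ou_measure \<rho>. f p = c * J \<rho> m n p"
proof -
  let ?ev = "ou_eigenvalue r \<Omega> m n"
  have f: "f \<in> L2_mu \<rho>" using gen by (simp add: ou_generator_def)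
  have J2: "J \<rho> k l \<in> L2_mu \<rho>" for k l using poly_growth_J pos(2) by (rule poly_growth_in_L2)
  note [measurable] = L2_mu_measurable[OF f] J2[THEN L2_mu_measurable]
  \<comment> \<open>As \<open>J \<rho> n m\<close> is the conjugate of \<open>J \<rho> m n\<close>,
    this bilinear pairing is the squared norm of \<open>J \<rho> m n\<close>, hence not 0.\<close>
  define N where "N = (LINT p|ou_measure \<rho>. J \<rho> m n p * J \<rho> n m p)"
  have "N \<noteq> 0"
  proof
    assume "N = 0"
    have "J \<rho> m n p * J \<rho> n m p = complex_of_real ((cmod (J \<rho> m n p))\<^sup>2)" for p
      unfolding J_swap[of \<rho> n m] by (simp add: complex_norm_square del: of_real_power)
    with \<open>N = 0\<close> have "(LINT p|ou_measure \<rho>. (cmod (J \<rho> m n p))\<^sup>2) = 0"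
      by (simp add: N_def del: of_real_power)
    then have "AE p in ou_measure \<rho>. (cmod (J \<rho> m n p))\<^sup>2 = 0"
      using J2[of m n] by (subst (asm) integral_nonneg_eq_0_iff_AE) (auto simp: L2_mu_def)
    then have "AE p in ou_measure \<rho>. J \<rho> m n p = 0" by simp
    with not_AE_J_eq_0[OF pos(2)] show False by blast
  qed
  \<comment> \<open>Distinct eigenvalues leave only the pairing with \<open>J \<rho> n m\<close>
    undecided; this coefficient makes it vanish for \<open>h\<close>, and \<open>h\<close> still
    satisfies the eigenvalue equation.\<close>
  define c where "c = (LINT p|ou_measure \<rho>. f p * J \<rho> n m p) / N"
  define h where "h p = f p - c * J \<rho> m n p" for p
  have gen_h: "ou_generator r \<Omega> \<rho> h (\<lambda>p. ?ev * h p)"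
    using ou_generator_diff_cmult[OF gen ou_generator_J[OF pos(1,2), of \<Omega> m n] pos(1,2), of c]
    by (simp add: h_def[abs_def] algebra_simps)
  have "(LINT p|ou_measure \<rho>. h p * J \<rho> k l p) = 0" for k l
  proof (cases "(k, l) = (n, m)")
    case True
    have "h p * J \<rho> n m p = f p * J \<rho> n m p - c * (J \<rho> m n p * J \<rho> n m p)" for p
      by (simp add: h_def algebra_simps)
    then have "(LINT p|ou_measure \<rho>. h p * J \<rho> n m p) = (LINT p|ou_measure \<rho>. f p * J \<rho> n m p) - c * N"
      unfolding N_def using L2_mu_mult_integrable[OF f J2] L2_mu_mult_integrable[OF J2 J2] by simp
    also have "\<dots> = 0" using \<open>N \<noteq> 0\<close> by (simp add: c_def)
    finally show ?thesis using True by simp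
  next
    case False
    with ou_eigenfunction_orthogonal[OF gen_h pos] show ?thesis .
  qed
  from ou_generator_orthogonal_AE_0[OF gen_h pos(1,2) this]
  have "AE p in ou_measure \<rho>. f p = c * J \<rho> m n p" by (simp add: h_def)
  then show ?thesis ..
qed

theorem theorem2p2:
  fixes r \<sigma> \<Omega> \<rho> :: real and m n :: nat and ev :: complex
  assumes "r > 0" and "\<sigma>\<^sup>2 > 0" and "\<Omega> \<noteq> 0" and "\<rho> = 2 * \<sigma>\<^sup>2 / r"
    and "ev = - complex_of_real r * (of_nat m + of_nat n)
              - \<i> * (of_nat m - of_nat n) * complex_of_real \<Omega>"
  shows "ou_eigenfunction r \<Omega> \<rho> ev (J \<rho> m n)
       \<and> (\<forall>p. ou_diff_op r \<sigma> \<Omega> (J \<rho> m n) p = ev * J \<rho> m n p)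
       \<and> (\<forall>f. ou_eigenfunction r \<Omega> \<rho> ev f \<longrightarrow>
              (\<exists>c. AE p in ou_measure \<rho>. f p = c * J \<rho> m n p))"
proof -
  have \<rho>: "\<rho> > 0" and r\<rho>: "r * \<rho> = 2 * \<sigma>\<^sup>2"
    using assms(1,2,4) by simp_all
  have ev: "ev = ou_eigenvalue r \<Omega> m n"
    using assms(5) by (simp only: ou_eigenvalue_def)
  have "ou_eigenfunction r \<Omega> \<rho> ev (J \<rho> m n)"
    unfolding ou_eigenfunction_def ev using not_AE_J_eq_0[OF \<rho>] ou_generator_J[OF assms(1) \<rho>] by blast
  moreover have "\<forall>p. ou_diff_op r \<sigma> \<Omega> (J \<rho> m n) p = ev * J \<rho> m n p"
    unfolding J_eq_planeherm assms(5) using ou_diff_op_planeherm[OF r\<rho>] by blast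
  moreover have "\<forall>f. ou_eigenfunction r \<Omega> \<rho> ev f \<longrightarrow> (\<exists>c. AE p in ou_measure \<rho>. f p = c * J \<rho> m n p)"
    unfolding ou_eigenfunction_def ev using ou_eigenfunction_unique[OF _ assms(1) \<rho> assms(3)] by blast
  ultimately show ?thesis by blast
qed

end
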